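(* Let $n,N\ge1$ and positive integers $r_1,\dots,r_N,r$ with $r_i\le r\le\lfloor(n-1)/2\rfloor$. Consider either (a) $d=n$, $m=r_i$, $p=r_i+1$, $q=n-r_i$ for some $i$, $\mathcal{A}(y)=\mathcal{H}_{r_i+1}(y)$; or (b) $d=Nn$, $m=r$, $p=r+1$, $q=N(n-r)$, $\mathcal{A}(y)=[\mathcal{H}_{r+1}(y_1)\cdots\mathcal{H}_{r+1}(y_N)]$ for $y=(y_1^\top,\dots,y_N^\top)^\top$. Fix $\hat y\in\mathbb{R}^d$, let $\Psi(R)=\inf_{y}\{\frac12\|y-\hat y\|^2: R\mathcal{A}(y)=0\}$ for $R\in\mathbb{R}^{1\times p}$, let $\Theta=\{R\in\mathbb{R}^{1\times p}:RR^\top=1\}$ and $\widetilde\Psi=\Psi+\delta_\Theta$. Let $R^*$ be a stationary point of $\widetilde\Psi$ (i.e. $0\in\partial\widetilde\Psi(R^* )$) and let $y^*$ attain the infimum defining $\Psi(R^* )$. Then $$0\in y^*-\hat y+\mathcal{A}^*\big(N_{\{X:\mathrm{rank}(X)\le m\}}(\mathcal{A}(y^* ))\big).$$ If in addition $\mathrm{rank}(\mathcal{A}(y^* ))=m$, then $$0\in y^*-\hat y+N_{\{y:\mathrm{rank}(\mathcal{A}(y))\le m\}}(y^* ).$$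
   Context: For $x\in\mathbb{R}^n$ and $1\le l\le n$, $\mathcal{H}_l(x)\in\mathbb{R}^{l\times(n-l+1)}$ is the Hankel matrix with $(i,j)$ entry $x(i+j-1)$. $\delta_\Theta$ is the indicator function of $\Theta$; $\partial$ denotes the limiting subdifferential and $N_S(x)$ the limiting normal cone of a closed set $S$ at $x$ (Rockafellar–Wets); $\mathcal{A}^*$ is the adjoint of $\mathcal{A}$ with respect to the Frobenius inner product. *)

theory Defs
  imports Complex_Main "HOL-Library.Extended_Real" "Jordan_Normal_Form.DL_Rank"
begin

definition gnorm :: "('a \<Rightarrow> 'a \<Rightarrow> real) \<Rightarrow> 'a \<Rightarrow> real" where
  "gnorm ip v = sqrt (ip v v)"

definition frob :: "real mat \<Rightarrow> real mat \<Rightarrow> real" where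
  "frob X Y = (\<Sum>i<dim_row X. \<Sum>j<dim_col X. X $$ (i, j) * Y $$ (i, j))"

definition vip :: "real vec \<Rightarrow> real vec \<Rightarrow> real" where
  "vip v w = v \<bullet> w"

definition frechet_normal ::
  "'a set \<Rightarrow> ('a \<Rightarrow> 'a \<Rightarrow> real) \<Rightarrow> 'a::minus set \<Rightarrow> 'a \<Rightarrow> 'a set" where
  "frechet_normal C ip S x = {v \<in> C. x \<in> S \<and>
     (\<forall>\<epsilon>>0. \<exists>\<delta>>0. \<forall>x'\<in>S. gnorm ip (x' - x) < \<delta> \<longrightarrow>
        ip v (x' - x) \<le> \<epsilon> * gnorm ip (x' - x))}"

definition limiting_normal ::
  "'a set \<Rightarrow> ('a \<Rightarrow> 'a \<Rightarrow> real) \<Rightarrow> 'a::minus set \<Rightarrow> 'a \<Rightarrow> 'a set" where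
  "limiting_normal C ip S x = {v \<in> C. x \<in> S \<and>
     (\<exists>xs vs. (\<forall>k. xs k \<in> S \<and> vs k \<in> frechet_normal C ip S (xs k)) \<and>
        (\<lambda>k. gnorm ip (xs k - x)) \<longlonglongrightarrow> 0 \<and>
        (\<lambda>k. gnorm ip (vs k - v)) \<longlonglongrightarrow> 0)}"

definition frechet_subdiff ::
  "'a set \<Rightarrow> ('a \<Rightarrow> 'a \<Rightarrow> real) \<Rightarrow> ('a::minus \<Rightarrow> ereal) \<Rightarrow> 'a \<Rightarrow> 'a set" where
  "frechet_subdiff C ip f x = {v \<in> C. x \<in> C \<and> \<bar>f x\<bar> \<noteq> \<infinity> \<and>
     (\<forall>\<epsilon>>0. \<exists>\<delta>>0. \<forall>x'\<in>C. gnorm ip (x' - x) < \<delta> \<longrightarrow>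
        ereal (real_of_ereal (f x) + ip v (x' - x) - \<epsilon> * gnorm ip (x' - x)) \<le> f x')}"

definition limiting_subdiff ::
  "'a set \<Rightarrow> ('a \<Rightarrow> 'a \<Rightarrow> real) \<Rightarrow> ('a::minus \<Rightarrow> ereal) \<Rightarrow> 'a \<Rightarrow> 'a set" where
  "limiting_subdiff C ip f x = {v \<in> C. x \<in> C \<and> \<bar>f x\<bar> \<noteq> \<infinity> \<and>
     (\<exists>xs vs. (\<forall>k. xs k \<in> C \<and> vs k \<in> frechet_subdiff C ip f (xs k)) \<and>
        (\<lambda>k. gnorm ip (xs k - x)) \<longlonglongrightarrow> 0 \<and>
        (\<lambda>k. f (xs k)) \<longlonglongrightarrow> f x \<and>
        (\<lambda>k. gnorm ip (vs k - v)) \<longlonglongrightarrow> 0)}"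

definition mrank :: "real mat \<Rightarrow> nat" where
  "mrank X = vec_space.rank (dim_row X) X"

(* Hankel matrix H_l(x) in R^{l x (n-l+1)}, entry (i,j) = x(i+j-1) (1-based);
   here 0-based: entry (i,j) = x $ (i+j) *)
definition hankel :: "nat \<Rightarrow> real vec \<Rightarrow> real mat" where
  "hankel l x = mat l (dim_vec x - l + 1) (\<lambda>(i, j). x $ (i + j))"

(* [H_l(y_1) ... H_l(y_N)] for y = (y_1; ...; y_N), each y_k in R^n *)
definition block_hankel :: "nat \<Rightarrow> nat \<Rightarrow> nat \<Rightarrow> real vec \<Rightarrow> real mat" where
  "block_hankel N n l y = mat l (N * (n - l + 1))
     (\<lambda>(i, j). y $ ((j div (n - l + 1)) * n + i + j mod (n - l + 1)))"

definition adjoint_op :: "nat \<Rightarrow> (real vec \<Rightarrow> real mat) \<Rightarrow> real mat \<Rightarrow> real vec" where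
  "adjoint_op d A Z = (THE w. w \<in> carrier_vec d \<and>
     (\<forall>y\<in>carrier_vec d. frob (A y) Z = vip y w))"

definition Psi :: "nat \<Rightarrow> nat \<Rightarrow> (real vec \<Rightarrow> real mat) \<Rightarrow> real vec \<Rightarrow> real mat \<Rightarrow> real" where
  "Psi d q A yhat R = Inf {(1/2) * (gnorm vip (y - yhat))\<^sup>2 | y.
      y \<in> carrier_vec d \<and> R * A y = 0\<^sub>m 1 q}"

definition Theta :: "nat \<Rightarrow> real mat set" where
  "Theta p = {R \<in> carrier_mat 1 p. R * R\<^sup>T = 1\<^sub>m 1}"

definition Psi_tilde :: "nat \<Rightarrow> nat \<Rightarrow> nat \<Rightarrow> (real vec \<Rightarrow> real mat) \<Rightarrow> real vec \<Rightarrow> real mat \<Rightarrow> ereal" where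
  "Psi_tilde d p q A yhat R = (if R \<in> Theta p then ereal (Psi d q A yhat R) else \<infinity>)"

end

theory Submission
  imports Defs "HOL-Analysis.L2_Norm" "Jordan_Normal_Form.Spectral_Radius"
begin

text \<open>For \<open>x \<noteq> 0\<close> the constraint \<open>x\<^sup>T A(y) = 0\<close> reads \<open>C(x) y = 0\<close> with a banded Toeplitz matrix \<open>C(x)\<close>
  of full row rank, because the adjoint \<open>C(x)\<^sup>T\<close> is an injective convolution. Hence the minimizer \<open>y\<close> is
  unique, \<open>y = yhat - C(x)\<^sup>T w\<close> with a multiplier \<open>w\<close>, and \<open>Psi\<close> is smooth near the sphere with gradient
  \<open>A(y) w\<close>. This gradient is orthogonal to \<open>x\<close>, so stationarity on the sphere forces \<open>A(y) w = 0\<close>. Thus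
  \<open>Z = x w\<^sup>T\<close> satisfies \<open>A(y)\<^sup>T Z = 0\<close> and \<open>A(y) Z\<^sup>T = 0\<close>, which makes it a limiting normal to the matrices
  of rank at most \<open>m\<close>: a Frechet normal at the matrices of rank exactly \<open>m\<close> annihilated by \<open>x\<close> and \<open>w\<close>,
  and these accumulate at \<open>A(y)\<close>. Since \<open>A\<^sup>*(Z) = C(x)\<^sup>T w = yhat - y\<close>, both claims follow.\<close>

section \<open>Norms and injective matrices\<close>

text \<open>With \<open>p = m + 1\<close> rows, rank at most \<open>m\<close> means that some unit
  vector annihilates the matrix from the left; all facts about the rank constraint are argued
  through such vectors. Smoothness of \<open>Psi\<close> enters as two estimates: a quadratic upper
  model at a KKT point, which a Frechet subgradient meets from below, and a Lipschitz bound for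
  \<open>A y *\<^sub>v w\<close> over nearby KKT triples, which carries the conclusion to limiting
  subgradients. Both rest on a lower bound for the transpose of \<open>C x\<close> that is uniform
  near \<open>x\<close>. In the first claim the obstacle is that the rank of \<open>A y\<close> may
  drop below \<open>m\<close>; nearby matrices must then be found that keep \<open>x\<close> as left
  and \<open>w\<close> as right null vector. Room for them is the inequality
  \<open>p \<le> q\<close>, supplied by \<open>r \<le> (n - 1) div 2\<close>. Those nearby matrices
  need not lie in the range of \<open>A\<close>, so this limiting normal cannot simply be pulled
  back along \<open>A\<close>. Rank exactly \<open>m\<close> makes the left null space a line; then
  the outer product is a Frechet normal at \<open>A y\<close> itself, and Frechet normals do pull
  back along linear maps.\<close>

abbreviation (input) vnorm :: "real vec \<Rightarrow> real" where "vnorm \<equiv> gnorm vip"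
abbreviation (input) mnorm :: "real mat \<Rightarrow> real" where "mnorm \<equiv> gnorm frob"

text \<open>Gives access to the triangle inequality and the Cauchy-Schwarz bound of
  \<open>L2_set\<close>; \<open>gnorm\<close> over an arbitrary form has neither.\<close>

lemma vnorm_L2: "vnorm v = L2_set (($) v) {..<dim_vec v}"
  by (simp add: gnorm_def vip_def scalar_prod_def L2_set_def power2_eq_square atLeast0LessThan)

lemma mnorm_L2: "mnorm X = L2_set (($$) X) ({..<dim_row X} \<times> {..<dim_col X})"
  by (simp add: gnorm_def frob_def L2_set_def power2_eq_square sum.cartesian_product)

lemma vnorm_nonneg [simp]: "0 \<le> vnorm v" by (simp add: vnorm_L2)
lemma mnorm_nonneg [simp]: "0 \<le> mnorm X" by (simp add: mnorm_L2)

lemma vnorm_sq: "(vnorm v)\<^sup>2 = v \<bullet> v"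
  by (simp add: vnorm_L2 L2_set_def sum_nonneg scalar_prod_def power2_eq_square atLeast0LessThan)

lemma vnorm_zero [simp]: "vnorm (0\<^sub>v k) = 0"
  by (simp add: vnorm_L2 L2_set_0')

lemma vnorm_eq_0: "vnorm v = 0 \<Longrightarrow> v \<in> carrier_vec k \<Longrightarrow> v = 0\<^sub>v k"
  by (auto simp: vnorm_L2 L2_set_eq_0_iff)

lemma vnorm_pos: "v \<in> carrier_vec k \<Longrightarrow> v \<noteq> 0\<^sub>v k \<Longrightarrow> 0 < vnorm v"
  using vnorm_eq_0[of v k] vnorm_nonneg[of v] by linarith

lemma vnorm_triangle:
  assumes "v \<in> carrier_vec k" "w \<in> carrier_vec k"
  shows "vnorm (v + w) \<le> vnorm v + vnorm w"
proof -
  have "vnorm (v + w) = L2_set (\<lambda>i. v $ i + w $ i) {..<k}"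
    unfolding vnorm_L2 using assms by (intro L2_set_cong) auto
  then show ?thesis using assms L2_set_triangle_ineq[of "($) v" "($) w" "{..<k}"] by (simp add: vnorm_L2)
qed

lemma vnorm_smult [simp]: "vnorm (c \<cdot>\<^sub>v v) = \<bar>c\<bar> * vnorm v"
proof -
  have "vnorm (c \<cdot>\<^sub>v v) = L2_set (\<lambda>i. \<bar>c\<bar> * v $ i) {..<dim_vec v}"
    by (simp add: vnorm_L2 L2_set_def power_mult_distrib)
  then show ?thesis by (simp add: vnorm_L2 L2_set_right_distrib)
qed

lemma vnorm_uminus [simp]: "vnorm (- v) = vnorm v"
  by (simp add: vnorm_L2 L2_set_def)

lemma vnorm_diff_triangle:
  assumes "v \<in> carrier_vec k" "w \<in> carrier_vec k"
  shows "vnorm (v - w) \<le> vnorm v + vnorm w"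
proof -
  have "v - w = v + (- w)" using assms by auto
  then show ?thesis using vnorm_triangle[of v k "- w"] assms by simp
qed

lemma scalar_prod_abs_le:
  assumes "v \<in> carrier_vec k" "w \<in> carrier_vec k"
  shows "\<bar>v \<bullet> w\<bar> \<le> vnorm v * vnorm w"
proof -
  have "\<bar>v \<bullet> w\<bar> \<le> (\<Sum>i<k. \<bar>v $ i\<bar> * \<bar>w $ i\<bar>)"
    unfolding scalar_prod_def using assms sum_abs[of "\<lambda>i. v $ i * w $ i" "{..<k}"]
    by (simp add: abs_mult atLeast0LessThan)
  also have "\<dots> \<le> vnorm v * vnorm w"
    using L2_set_mult_ineq[of "($) v" "($) w" "{..<k}"] assms by (simp add: vnorm_L2)
  finally show ?thesis .
qed

lemma abs_index_le_vnorm: "i < dim_vec v \<Longrightarrow> \<bar>v $ i\<bar> \<le> vnorm v"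
  using member_le_L2_set[of "{..<dim_vec v}" i "\<lambda>i. \<bar>v $ i\<bar>"] by (simp add: vnorm_L2 L2_set_def)

lemma mnorm_transpose [simp]: "mnorm X\<^sup>T = mnorm X"
proof -
  have "frob X\<^sup>T X\<^sup>T = frob X X"
    unfolding frob_def by (subst sum.swap) simp
  then show ?thesis by (simp add: gnorm_def)
qed

lemma mnorm_smult [simp]: "mnorm (c \<cdot>\<^sub>m X) = \<bar>c\<bar> * mnorm X"
proof -
  have "mnorm (c \<cdot>\<^sub>m X) = L2_set (\<lambda>z. \<bar>c\<bar> * X $$ z) ({..<dim_row X} \<times> {..<dim_col X})"
    unfolding mnorm_L2 L2_set_def by (auto simp: power_mult_distrib intro!: sum.cong)
  then show ?thesis by (simp add: mnorm_L2 L2_set_right_distrib)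
qed

lemma mnorm_zero [simp]: "mnorm (0\<^sub>m k l) = 0"
  by (auto simp: mnorm_L2 intro!: L2_set_0')

text \<open>Crude, by comparison with the sum of absolute entries; only linearity in
  \<open>b\<close> matters later.\<close>

lemma mnorm_le_entries:
  assumes "\<And>i j. i < dim_row X \<Longrightarrow> j < dim_col X \<Longrightarrow> \<bar>X $$ (i, j)\<bar> \<le> b"
  shows "mnorm X \<le> real (dim_row X * dim_col X) * b"
proof -
  have "mnorm X \<le> (\<Sum>z\<in>{..<dim_row X} \<times> {..<dim_col X}. \<bar>X $$ z\<bar>)"
    unfolding mnorm_L2 by (rule L2_set_le_sum_abs)
  also have "\<dots> \<le> (\<Sum>z\<in>{..<dim_row X} \<times> {..<dim_col X}. b)"
    using assms by (intro sum_mono) auto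
  finally show ?thesis by (simp add: card_cartesian_product)
qed

text \<open>Cauchy-Schwarz in each row, summed: the Frobenius norm dominates the operator
  norm.\<close>

lemma vnorm_mult_mat_vec:
  assumes "X \<in> carrier_mat k l" "v \<in> carrier_vec l"
  shows "vnorm (X *\<^sub>v v) \<le> mnorm X * vnorm v"
proof -
  have "(X *\<^sub>v v) \<bullet> (X *\<^sub>v v) = (\<Sum>i<k. (row X i \<bullet> v)\<^sup>2)"
    using assms by (simp add: scalar_prod_def[of "X *\<^sub>v v"] power2_eq_square atLeast0LessThan)
  also have "\<dots> \<le> (\<Sum>i<k. (row X i \<bullet> row X i) * (v \<bullet> v))"
  proof (rule sum_mono)
    fix i assume "i \<in> {..<k}"
    have "\<bar>row X i \<bullet> v\<bar> \<le> \<bar>vnorm (row X i) * vnorm v\<bar>"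
      using scalar_prod_abs_le[of "row X i" l v] assms row_carrier[of X i] by auto
    then have "(row X i \<bullet> v)\<^sup>2 \<le> (vnorm (row X i) * vnorm v)\<^sup>2" by (simp only: abs_le_square_iff)
    then show "(row X i \<bullet> v)\<^sup>2 \<le> (row X i \<bullet> row X i) * (v \<bullet> v)"
      by (simp add: power_mult_distrib vnorm_sq)
  qed
  also have "\<dots> = frob X X * (v \<bullet> v)"
    using assms by (simp add: sum_distrib_right frob_def scalar_prod_def atLeast0LessThan)
  finally have "sqrt ((X *\<^sub>v v) \<bullet> (X *\<^sub>v v)) \<le> sqrt (frob X X * (v \<bullet> v))" by simp
  then show ?thesis by (simp add: gnorm_def vip_def real_sqrt_mult)
qed

section \<open>Adjoints, Gram matrices and lower bounds for injective maps\<close>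

lemma mult_mat_vec_adjoint:
  fixes M :: "real mat"
  assumes "M \<in> carrier_mat k l" "v \<in> carrier_vec l" "w \<in> carrier_vec k"
  shows "w \<bullet> (M *\<^sub>v v) = (M\<^sup>T *\<^sub>v w) \<bullet> v"
  using transpose_vec_mult_scalar[OF assms] assms by simp

lemma scalar_prod_self_eq_0:
  fixes v :: "real vec"
  assumes "v \<bullet> v = 0" "v \<in> carrier_vec k" shows "v = 0\<^sub>v k"
  using assms vnorm_eq_0[of v k] vnorm_sq[of v] by simp

lemma real_inverse_matrix:
  fixes G :: "real mat"
  assumes G: "G \<in> carrier_mat k k" and inj: "\<And>v. v \<in> carrier_vec k \<Longrightarrow> G *\<^sub>v v = 0\<^sub>v k \<Longrightarrow> v = 0\<^sub>v k"
  obtains H where "H \<in> carrier_mat k k" "H * G = 1\<^sub>m k" "G * H = 1\<^sub>m k"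
proof -
  have "det G \<noteq> 0" using det_0_iff_vec_prod_zero[OF G] inj by blast
  from det_non_zero_imp_unit[OF G this]
  have "\<exists>H\<in>carrier_mat k k. H * G = 1\<^sub>m k \<and> G * H = 1\<^sub>m k"
    unfolding Units_def by (simp add: ring_mat_def)
  then show ?thesis using that by blast
qed

text \<open>Pairing \<open>v\<close> with its image under the Gram matrix gives the squared norm of
  \<open>M *\<^sub>v v\<close>.\<close>

lemma gram_inj:
  fixes M :: "real mat"
  assumes M: "M \<in> carrier_mat k l" and inj: "\<And>v. v \<in> carrier_vec l \<Longrightarrow> M *\<^sub>v v = 0\<^sub>v k \<Longrightarrow> v = 0\<^sub>v l"
    and v: "v \<in> carrier_vec l" and 0: "(M\<^sup>T * M) *\<^sub>v v = 0\<^sub>v l"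
  shows "v = 0\<^sub>v l"
proof -
  have "(M *\<^sub>v v) \<bullet> (M *\<^sub>v v) = v \<bullet> ((M\<^sup>T * M) *\<^sub>v v)"
    using M v mult_mat_vec_adjoint[of "M\<^sup>T" l k "M *\<^sub>v v" v] by (simp add: assoc_mult_mat_vec[of _ l k _ l])
  then have "(M *\<^sub>v v) \<bullet> (M *\<^sub>v v) = 0" using 0 v by simp
  then show ?thesis using inj[OF v] scalar_prod_self_eq_0[of "M *\<^sub>v v" k] mult_mat_vec_carrier[OF M v] by blast
qed

lemma injective_lower_bound:
  fixes M :: "real mat"
  assumes M: "M \<in> carrier_mat k l" and inj: "\<And>v. v \<in> carrier_vec l \<Longrightarrow> M *\<^sub>v v = 0\<^sub>v k \<Longrightarrow> v = 0\<^sub>v l"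
  obtains c where "c > 0" "\<And>v. v \<in> carrier_vec l \<Longrightarrow> c * vnorm v \<le> vnorm (M *\<^sub>v v)"
proof -
  obtain H where H: "H \<in> carrier_mat l l" "H * (M\<^sup>T * M) = 1\<^sub>m l"
  proof (rule real_inverse_matrix)
    show "M\<^sup>T * M \<in> carrier_mat l l" using M by simp
    show "v = 0\<^sub>v l" if "v \<in> carrier_vec l" "(M\<^sup>T * M) *\<^sub>v v = 0\<^sub>v l" for v
      using gram_inj[OF M inj that] by simp
  qed
  \<comment> \<open>\<open>H * M\<^sup>T\<close> is a left inverse of \<open>M\<close>, so its norm
    controls \<open>v\<close> by \<open>M *\<^sub>v v\<close>; the \<open>1\<close> keeps
    \<open>b\<close> positive even for \<open>l = 0\<close>.\<close>
  define b where "b = mnorm (H * M\<^sup>T) + 1"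
  have b: "b > 0" unfolding b_def using mnorm_nonneg[of "H * M\<^sup>T"] by linarith
  have "(1 / b) * vnorm v \<le> vnorm (M *\<^sub>v v)" if v: "v \<in> carrier_vec l" for v
  proof -
    have "v = (H * (M\<^sup>T * M)) *\<^sub>v v" using H(2) v by simp
    also have "H * (M\<^sup>T * M) = (H * M\<^sup>T) * M"
      using H(1) M assoc_mult_mat[of H l l "M\<^sup>T" k M l] by simp
    also have "((H * M\<^sup>T) * M) *\<^sub>v v = (H * M\<^sup>T) *\<^sub>v (M *\<^sub>v v)"
      using H(1) M v assoc_mult_mat_vec[of "H * M\<^sup>T" l k M l v] by auto
    finally have "vnorm v \<le> mnorm (H * M\<^sup>T) * vnorm (M *\<^sub>v v)"
      using vnorm_mult_mat_vec[of "H * M\<^sup>T" l k "M *\<^sub>v v"] H(1) M v by simp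
    also have "\<dots> \<le> b * vnorm (M *\<^sub>v v)" unfolding b_def by (intro mult_right_mono) auto
    finally show ?thesis using b by (simp add: field_simps)
  qed
  then show ?thesis using that[of "1 / b"] b by simp
qed

section \<open>Rank and left null vectors\<close>

text \<open>A maximal independent set of columns: its size is the rank, and maximality makes it span
  the column space. It serves both directions between rank and left null vectors.\<close>

lemma (in vec_space) rank_basis:
  assumes X: "X \<in> carrier_mat n k"
  obtains U where "finite U" "U \<subseteq> carrier_vec n" "U \<subseteq> set (cols X)" "lin_indpt U" "card U = rank X"
    "span (set (cols X)) \<subseteq> span U"
proof -
  let ?P = "\<lambda>T. T \<subseteq> set (cols X) \<and> lin_indpt T"
  have cols: "set (cols X) \<subseteq> carrier_vec n" using X cols_dim by blast
  have "?P {}" by (meson empty_iff empty_subsetI finite.emptyI finite_lin_indpt2)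
  then obtain U where U: "finite U" "maximal U ?P"
    using maximal_exists_superset[of "set (cols X)" ?P "{}"] by blast
  have P: "U \<subseteq> set (cols X)" "lin_indpt U" using U(2) by (auto simp: maximal_def)
  have "set (cols X) \<subseteq> span U"
  proof
    fix c assume c: "c \<in> set (cols X)"
    show "c \<in> span U"
    proof (rule ccontr)
      assume nin: "c \<notin> span U"
      have "c \<notin> U" using nin in_own_span[of U] P cols by auto
      moreover from this have "lin_indpt (U \<union> {c})"
        using nin lin_dep_iff_in_span[of U c] P cols c by auto
      ultimately show False using U(2) c P by (auto simp: maximal_def)
    qed
  qed
  then have "span (set (cols X)) \<subseteq> span U"
    using span_is_subset[of "set (cols X)" "span U"] span_is_submodule[of U] P cols by simp
  then show ?thesis using that[OF U(1) _ P] P cols rank_card_indpt[OF X U(2)] by simp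
qed

lemma transpose_null_iff:
  fixes X :: "real mat"
  assumes "X \<in> carrier_mat k l" "v \<in> carrier_vec k"
  shows "X\<^sup>T *\<^sub>v v = 0\<^sub>v l \<longleftrightarrow> (\<forall>u\<in>set (cols X). v \<bullet> u = 0)"
proof -
  have "X\<^sup>T *\<^sub>v v = 0\<^sub>v l \<longleftrightarrow> (\<forall>j<l. col X j \<bullet> v = 0)"
    using assms by (auto simp: vec_eq_iff)
  also have "\<dots> \<longleftrightarrow> (\<forall>j<l. v \<bullet> col X j = 0)"
    using assms by (metis carrier_matD(1) carrier_vecI comm_scalar_prod dim_col)
  finally show ?thesis using assms by (auto simp: cols_def)
qed

lemma orthogonal_span:
  fixes v :: "real vec"
  assumes "U \<subseteq> carrier_vec k" "v \<in> carrier_vec k" "\<And>u. u \<in> U \<Longrightarrow> v \<bullet> u = 0"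
    and "w \<in> LinearCombinations.module.span class_ring (module_vec TYPE(real) k) U"
  shows "v \<bullet> w = 0"
proof -
  interpret V: vec_space "TYPE(real)" k .
  have "v \<in> V.orthogonal_complement U" using assms by (auto simp: V.orthogonal_complement_def)
  then have "v \<in> V.orthogonal_complement (V.span U)" using assms by simp
  then show ?thesis using assms by (auto simp: V.orthogonal_complement_def)
qed

text \<open>Otherwise \<open>m + 1\<close> independent columns form a basis, and \<open>v\<close>,
  orthogonal to all of them, is orthogonal to itself.\<close>

lemma mrank_le_of_left_null:
  assumes X: "X \<in> carrier_mat (Suc m) l" and v: "v \<in> carrier_vec (Suc m)" "v \<noteq> 0\<^sub>v (Suc m)"
    and null: "X\<^sup>T *\<^sub>v v = 0\<^sub>v l"
  shows "mrank X \<le> m"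
proof (rule ccontr)
  assume "\<not> mrank X \<le> m"
  interpret V: vec_space "TYPE(real)" "Suc m" .
  obtain U where U: "finite U" "U \<subseteq> carrier_vec (Suc m)" "U \<subseteq> set (cols X)" "V.lin_indpt U" "card U = V.rank X"
      "V.span (set (cols X)) \<subseteq> V.span U"
    by (rule V.rank_basis[OF X])
  have "V.rank X > m" using \<open>\<not> mrank X \<le> m\<close> X by (simp add: mrank_def)
  then have "V.basis U" using V.dim_li_is_basis[of U] U V.dim_is_n by simp
  then have "v \<in> V.span U" using v by (simp add: V.basis_def)
  moreover have "v \<bullet> u = 0" if "u \<in> U" for u using that U null transpose_null_iff[OF X v(1)] by blast
  ultimately have "v \<bullet> v = 0" using orthogonal_span[OF U(2) v(1)] by blast
  then show False using scalar_prod_self_eq_0 v by blast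
qed

text \<open>If the transpose were injective, \<open>X * X\<^sup>T\<close> would be invertible; then
  \<open>z = X *\<^sub>v (X\<^sup>T *\<^sub>v (H *\<^sub>v z))\<close> puts every \<open>z\<close>
  into the column space, which forces rank \<open>m + 1\<close>.\<close>

lemma left_null_of_mrank_le:
  assumes X: "X \<in> carrier_mat (Suc m) l" and rank: "mrank X \<le> m"
  obtains v where "v \<in> carrier_vec (Suc m)" "vnorm v = 1" "X\<^sup>T *\<^sub>v v = 0\<^sub>v l"
proof -
  let ?p = "Suc m"
  interpret V: vec_space "TYPE(real)" ?p .
  have "\<exists>v\<in>carrier_vec ?p. v \<noteq> 0\<^sub>v ?p \<and> X\<^sup>T *\<^sub>v v = 0\<^sub>v l"
  proof (rule ccontr)
    assume "\<not> ?thesis"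
    then have inj: "v = 0\<^sub>v ?p" if "v \<in> carrier_vec ?p" "X\<^sup>T *\<^sub>v v = 0\<^sub>v l" for v using that by blast
    have XT: "X\<^sup>T \<in> carrier_mat l ?p" using X by simp
    obtain H where H: "H \<in> carrier_mat ?p ?p" "(X\<^sup>T\<^sup>T * X\<^sup>T) * H = 1\<^sub>m ?p"
    proof (rule real_inverse_matrix)
      show "X\<^sup>T\<^sup>T * X\<^sup>T \<in> carrier_mat ?p ?p" using X by simp
      show "v = 0\<^sub>v ?p" if "v \<in> carrier_vec ?p" "(X\<^sup>T\<^sup>T * X\<^sup>T) *\<^sub>v v = 0\<^sub>v ?p" for v
        using gram_inj[OF XT inj that] by simp
    qed
    obtain U where U: "finite U" "U \<subseteq> carrier_vec ?p" "U \<subseteq> set (cols X)" "V.lin_indpt U" "card U = V.rank X"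
      "V.span (set (cols X)) \<subseteq> V.span U"
      by (rule V.rank_basis[OF X])
    have "z \<in> V.span U" if z: "z \<in> carrier_vec ?p" for z
    proof -
      have "z = ((X * X\<^sup>T) * H) *\<^sub>v z" using H z by simp
      also have "\<dots> = (X * X\<^sup>T) *\<^sub>v (H *\<^sub>v z)"
        using X H z assoc_mult_mat_vec[of "X * X\<^sup>T" ?p ?p H ?p z] by auto
      also have "\<dots> = X *\<^sub>v (X\<^sup>T *\<^sub>v (H *\<^sub>v z))"
        using X H z assoc_mult_mat_vec[of X ?p l "X\<^sup>T" ?p "H *\<^sub>v z"] by auto
      finally have "X *\<^sub>v (X\<^sup>T *\<^sub>v (H *\<^sub>v z)) = z" by simp
      moreover have "X\<^sup>T *\<^sub>v (H *\<^sub>v z) \<in> carrier_vec l" 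
        using X H z mult_mat_vec_carrier[of "X\<^sup>T" l ?p "H *\<^sub>v z"] by simp
      ultimately have "z \<in> V.col_space X" using V.col_space_eq[OF X] X z by auto
      then show ?thesis using U(6) by (auto simp: V.col_space_def)
    qed
    moreover have "V.span U \<subseteq> carrier_vec ?p" using V.span_is_subset2[of U] U(2) by simp
    ultimately have "V.basis U" using U unfolding V.basis_def by auto
    then have "V.dim = card U" using V.dim_basis U(1) by blast
    then show False using U(5) V.dim_is_n rank X by (simp add: mrank_def)
  qed
  then obtain v where v: "v \<in> carrier_vec ?p" "v \<noteq> 0\<^sub>v ?p" "X\<^sup>T *\<^sub>v v = 0\<^sub>v l" by blast
  have "vnorm v > 0" using vnorm_pos v by blast
  moreover have "X\<^sup>T *\<^sub>v ((1 / vnorm v) \<cdot>\<^sub>v v) = 0\<^sub>v l"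
    using X v mult_mat_vec[of "X\<^sup>T" l ?p v "1 / vnorm v"] by auto
  ultimately show ?thesis using that[of "(1 / vnorm v) \<cdot>\<^sub>v v"] v by simp
qed

text \<open>The \<open>m\<close> independent columns and \<open>x\<close>, which is orthogonal to
  them, form a basis. The part of \<open>v\<close> orthogonal to \<open>x\<close> is orthogonal to
  this whole basis, hence zero.\<close>

lemma left_null_unique:
  assumes X: "X \<in> carrier_mat (Suc m) l" and rank: "mrank X = m"
    and x: "x \<in> carrier_vec (Suc m)" "vnorm x = 1" "X\<^sup>T *\<^sub>v x = 0\<^sub>v l"
    and v: "v \<in> carrier_vec (Suc m)" "X\<^sup>T *\<^sub>v v = 0\<^sub>v l"
  shows "v = (x \<bullet> v) \<cdot>\<^sub>v x"
proof -
  let ?p = "Suc m"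
  interpret V: vec_space "TYPE(real)" ?p .
  have xx: "x \<bullet> x = 1" using vnorm_sq[of x] x by simp
  obtain U where U: "finite U" "U \<subseteq> carrier_vec ?p" "U \<subseteq> set (cols X)" "V.lin_indpt U" "card U = V.rank X"
      "V.span (set (cols X)) \<subseteq> V.span U"
    by (rule V.rank_basis[OF X])
  have orth: "y \<bullet> u = 0" if "y \<in> carrier_vec ?p" "X\<^sup>T *\<^sub>v y = 0\<^sub>v l" "u \<in> U" for y u
    using that U transpose_null_iff[OF X that(1)] by blast
  have "x \<notin> V.span U" using orthogonal_span[OF U(2) x(1) orth[OF x(1,3)], of x] xx by auto
  moreover from this have "x \<notin> U" using V.in_own_span[of U] U by auto
  ultimately have indep: "V.lin_indpt (U \<union> {x})"
    using V.lin_dep_iff_in_span[of U x] U x by auto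
  have "V.basis (U \<union> {x})"
    using V.dim_li_is_basis[of "U \<union> {x}"] indep \<open>x \<notin> U\<close> U V.dim_is_n rank X x by (simp add: mrank_def)
  moreover define s where "s = v - (x \<bullet> v) \<cdot>\<^sub>v x"
  moreover have s: "s \<in> carrier_vec ?p" using v x by (simp add: s_def)
  ultimately have "s \<in> V.span (U \<union> {x})" by (simp add: V.basis_def)
  moreover have "s \<bullet> u = 0" if "u \<in> U \<union> {x}" for u
  proof -
    have u: "u \<in> carrier_vec ?p" using that U x by auto
    have "s \<bullet> u = v \<bullet> u - (x \<bullet> v) * (x \<bullet> u)"
      unfolding s_def using minus_scalar_prod_distrib[of v ?p "(x \<bullet> v) \<cdot>\<^sub>v x" u] v x u by simp
    then show ?thesis using that orth[OF x(1,3)] orth[OF v] xx comm_scalar_prod[OF v(1) x(1)] by auto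
  qed
  ultimately have "s \<bullet> s = 0" using orthogonal_span[of "U \<union> {x}" ?p s] U x s by auto
  then have "s = 0\<^sub>v ?p" using scalar_prod_self_eq_0 s by blast
  then show ?thesis
    using v x by (auto simp: s_def vec_eq_iff)
qed

section \<open>Normals to the matrices of bounded rank\<close>

lemma smult_mat_mult_vec:
  fixes X :: "real mat"
  assumes "X \<in> carrier_mat k l" "v \<in> carrier_vec l"
  shows "(c \<cdot>\<^sub>m X) *\<^sub>v v = c \<cdot>\<^sub>v (X *\<^sub>v v)"
  using assms by (auto simp: scalar_prod_def sum_distrib_left mult.assoc)

definition outer :: "real vec \<Rightarrow> real vec \<Rightarrow> real mat" where
  "outer x y = mat (dim_vec x) (dim_vec y) (\<lambda>(i, j). x $ i * y $ j)"

lemma outer_carrier [simp]: "x \<in> carrier_vec k \<Longrightarrow> y \<in> carrier_vec l \<Longrightarrow> outer x y \<in> carrier_mat k l"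
  by (simp add: outer_def)

lemma frob_commute:
  assumes "X \<in> carrier_mat k l" "Y \<in> carrier_mat k l"
  shows "frob X Y = frob Y X"
  using assms by (simp add: frob_def mult.commute)

lemma frob_outer:
  assumes "x \<in> carrier_vec k" "y \<in> carrier_vec l" "D \<in> carrier_mat k l"
  shows "frob (outer x y) D = x \<bullet> (D *\<^sub>v y)"
  using assms by (simp add: frob_def outer_def scalar_prod_def atLeast0LessThan sum_distrib_left mult_ac)

lemma outer_mult_vec:
  assumes "x \<in> carrier_vec k" "y \<in> carrier_vec l" "v \<in> carrier_vec l"
  shows "outer x y *\<^sub>v v = (y \<bullet> v) \<cdot>\<^sub>v x"
proof (rule eq_vecI)
  fix i assume "i < dim_vec ((y \<bullet> v) \<cdot>\<^sub>v x)"
  then show "(outer x y *\<^sub>v v) $ i = ((y \<bullet> v) \<cdot>\<^sub>v x) $ i"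
    using assms by (simp add: outer_def scalar_prod_def sum_distrib_left sum_distrib_right mult_ac)
qed (use assms in \<open>simp add: outer_def\<close>)

lemma mult_mat_vec_zero: "X \<in> carrier_mat k l \<Longrightarrow> X *\<^sub>v 0\<^sub>v l = 0\<^sub>v k" for X :: "real mat"
  by auto

text \<open>If \<open>v\<close> is a unit left null vector of \<open>X'\<close>, then the component of \<open>v\<close> orthogonal to \<open>x\<close> is
  \<open>O(\<parallel>X' - X\<parallel>)\<close>, so \<open>x \<bullet> X'y\<close> is of second order in \<open>X' - X\<close>.\<close>

lemma outer_frechet_normal:
  assumes X: "X \<in> carrier_mat (Suc m) l" and x: "x \<in> carrier_vec (Suc m)" "vnorm x = 1"
    and y: "y \<in> carrier_vec l" and null: "X\<^sup>T *\<^sub>v x = 0\<^sub>v l" "X *\<^sub>v y = 0\<^sub>v (Suc m)"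
    and uniq: "\<And>v. v \<in> carrier_vec (Suc m) \<Longrightarrow> X\<^sup>T *\<^sub>v v = 0\<^sub>v l \<Longrightarrow> v = (x \<bullet> v) \<cdot>\<^sub>v x"
  shows "outer x y \<in> frechet_normal (carrier_mat (Suc m) l) frob {X \<in> carrier_mat (Suc m) l. mrank X \<le> m} X"
proof -
  let ?p = "Suc m"
  have xx: "x \<bullet> x = 1" using vnorm_sq[of x] x by simp
  have x0: "x \<noteq> 0\<^sub>v ?p" using x by auto
  \<comment> \<open>Adding \<open>outer x x\<close> fills the one missing direction:
    \<open>v \<bullet> (M *\<^sub>v v)\<close> is the squared norm of
    \<open>X\<^sup>T *\<^sub>v v\<close> plus the square of \<open>x \<bullet> v\<close>, so
    \<open>uniq\<close> makes \<open>M\<close> injective.\<close>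
  define M where "M = X * X\<^sup>T + outer x x"
  have outer_mult: "outer x x *\<^sub>v v = (x \<bullet> v) \<cdot>\<^sub>v x" if "v \<in> carrier_vec ?p" for v
    using outer_mult_vec x(1) that by blast
  have M: "M \<in> carrier_mat ?p ?p" using X x by (simp add: M_def)
  have Mv: "M *\<^sub>v v = X *\<^sub>v (X\<^sup>T *\<^sub>v v) + (x \<bullet> v) \<cdot>\<^sub>v x" if v: "v \<in> carrier_vec ?p" for v
    unfolding M_def using X x v outer_mult[OF v]
      add_mult_distrib_mat_vec[of "X * X\<^sup>T" ?p ?p "outer x x" v] assoc_mult_mat_vec[of X ?p l "X\<^sup>T" ?p v]
    by simp
  have "v = 0\<^sub>v ?p" if v: "v \<in> carrier_vec ?p" and 0: "M *\<^sub>v v = 0\<^sub>v ?p" for v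
  proof -
    have XTv: "X\<^sup>T *\<^sub>v v \<in> carrier_vec l" using mult_mat_vec_carrier[of "X\<^sup>T" l ?p v] X v by simp
    have "0 = v \<bullet> (M *\<^sub>v v)" using 0 v by simp
    also have "\<dots> = v \<bullet> (X *\<^sub>v (X\<^sup>T *\<^sub>v v)) + (x \<bullet> v) * (v \<bullet> x)"
      unfolding Mv[OF v] using X v x XTv by (subst scalar_prod_add_distrib[of _ ?p]) auto
    also have "v \<bullet> (X *\<^sub>v (X\<^sup>T *\<^sub>v v)) = (X\<^sup>T *\<^sub>v v) \<bullet> (X\<^sup>T *\<^sub>v v)"
      using mult_mat_vec_adjoint[OF X XTv v] .
    also have "v \<bullet> x = x \<bullet> v" using comm_scalar_prod v x by blast
    finally have "(X\<^sup>T *\<^sub>v v) \<bullet> (X\<^sup>T *\<^sub>v v) + (x \<bullet> v) * (x \<bullet> v) = 0" by simp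
    then have "(vnorm (X\<^sup>T *\<^sub>v v))\<^sup>2 + (x \<bullet> v)\<^sup>2 = 0" by (simp only: vnorm_sq power2_eq_square[of "x \<bullet> v"])
    then have "vnorm (X\<^sup>T *\<^sub>v v) = 0" "x \<bullet> v = 0" by (simp_all only: sum_power2_eq_zero_iff)
    then show ?thesis using uniq[OF v] vnorm_eq_0[OF _ XTv] x by auto
  qed
  then obtain c where c: "c > 0" "\<And>v. v \<in> carrier_vec ?p \<Longrightarrow> c * vnorm v \<le> vnorm (M *\<^sub>v v)"
    using injective_lower_bound[OF M] by blast
  \<comment> \<open>The constant in \<open>vnorm s \<le> C * mnorm D\<close>, where \<open>s\<close>
    is the part of \<open>v\<close> orthogonal to \<open>x\<close>; the \<open>1\<close> keeps it
    positive for the radius \<open>1 / (2 * C)\<close>.\<close>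
  define C where "C = mnorm X / c + 1"
  have C: "C > 0" using c(1) mnorm_nonneg[of X] by (simp add: C_def add_nonneg_pos)
  have key: "\<bar>x \<bullet> ((X' - X) *\<^sub>v y)\<bar> \<le> 2 * C * vnorm y * mnorm (X' - X) * mnorm (X' - X)"
    if X': "X' \<in> carrier_mat ?p l" "mrank X' \<le> m" and small: "C * mnorm (X' - X) \<le> 1 / 2" for X'
  proof -
    obtain v where v: "v \<in> carrier_vec ?p" "vnorm v = 1" "X'\<^sup>T *\<^sub>v v = 0\<^sub>v l"
      by (rule left_null_of_mrank_le[OF X'])
    define D where "D = X' - X"
    define a where "a = x \<bullet> v"
    define s where "s = v - a \<cdot>\<^sub>v x"
    have D: "D \<in> carrier_mat ?p l" using X by (simp add: D_def minus_carrier_mat)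
    have s: "s \<in> carrier_vec ?p" using v x by (simp add: s_def)
    have xs: "x \<bullet> s = 0"
      unfolding s_def using v x xx by (subst scalar_prod_minus_distrib[of _ ?p]) (auto simp: a_def)
    have XTs: "X\<^sup>T *\<^sub>v s = - (D\<^sup>T *\<^sub>v v)"
    proof -
      have "X\<^sup>T *\<^sub>v s = X\<^sup>T *\<^sub>v v - a \<cdot>\<^sub>v (X\<^sup>T *\<^sub>v x)"
        unfolding s_def using X v x mult_minus_distrib_mat_vec[of "X\<^sup>T" l ?p v "a \<cdot>\<^sub>v x"]
          mult_mat_vec[of "X\<^sup>T" l ?p x a] by simp
      moreover have "D\<^sup>T *\<^sub>v v = X'\<^sup>T *\<^sub>v v - X\<^sup>T *\<^sub>v v"
        unfolding D_def using X X' v minus_mult_distrib_mat_vec[of "X'\<^sup>T" l ?p "X\<^sup>T" v]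
        by (simp add: transpose_minus)
      ultimately show ?thesis using null(1) v(3) X X' by auto
    qed
    \<comment> \<open>Since \<open>x \<bullet> s = 0\<close>, \<open>M\<close> acts on
      \<open>s\<close> as \<open>X * X\<^sup>T\<close>, and \<open>X\<^sup>T *\<^sub>v s\<close> is
      already of first order in \<open>D\<close>.\<close>
    have "c * vnorm s \<le> vnorm (M *\<^sub>v s)" using c(2) s .
    also have "M *\<^sub>v s = X *\<^sub>v (X\<^sup>T *\<^sub>v s)" using Mv[OF s] xs X x s by auto
    also have "vnorm \<dots> \<le> mnorm X * vnorm (X\<^sup>T *\<^sub>v s)"
      using vnorm_mult_mat_vec[OF X, of "X\<^sup>T *\<^sub>v s"] mult_mat_vec_carrier[of "X\<^sup>T" l ?p s] X s by simp
    also have "vnorm (X\<^sup>T *\<^sub>v s) \<le> mnorm D"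
      using vnorm_mult_mat_vec[of "D\<^sup>T" l ?p v] D v by (simp add: XTs)
    finally have "c * vnorm s \<le> mnorm X * mnorm D" by (simp add: mult_left_mono)
    then have "vnorm s \<le> mnorm X / c * mnorm D" using c(1) by (simp add: field_simps)
    also have "\<dots> \<le> C * mnorm D" unfolding C_def by (intro mult_right_mono) auto
    finally have ns: "vnorm s \<le> C * mnorm D" .
    have va: "v = a \<cdot>\<^sub>v x + s" using v x by (auto simp: s_def)
    have "vnorm v \<le> \<bar>a\<bar> * vnorm x + vnorm s" using vnorm_triangle[of "a \<cdot>\<^sub>v x" ?p s] x s by (simp add: va[symmetric])
    then have a: "\<bar>a\<bar> \<ge> 1 / 2" using v x ns small by (simp add: D_def)
    have Dy: "D *\<^sub>v y \<in> carrier_vec ?p" using D y by simp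
    \<comment> \<open>\<open>X *\<^sub>v y\<close> vanishes and \<open>v\<close> annihilates
      \<open>X'\<close> from the left, so writing \<open>v = a \<cdot>\<^sub>v x + s\<close> trades
      \<open>x\<close> for the small vector \<open>s\<close>.\<close>
    have "v \<bullet> (D *\<^sub>v y) = 0"
    proof -
      have "D *\<^sub>v y = X' *\<^sub>v y - X *\<^sub>v y" unfolding D_def using X X' y by (intro minus_mult_distrib_mat_vec)
      then have "D *\<^sub>v y = X' *\<^sub>v y" using null(2) X' y by auto
      then show ?thesis using mult_mat_vec_adjoint[OF X'(1) y v(1)] v(3) y by simp
    qed
    then have "a * (x \<bullet> (D *\<^sub>v y)) = - (s \<bullet> (D *\<^sub>v y))"
      using x s Dy by (subst (asm) va) (simp add: add_scalar_prod_distrib[of _ ?p])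
    then have "\<bar>a\<bar> * \<bar>x \<bullet> (D *\<^sub>v y)\<bar> = \<bar>s \<bullet> (D *\<^sub>v y)\<bar>" by (metis abs_minus_cancel abs_mult)
    also have "\<dots> \<le> vnorm s * vnorm (D *\<^sub>v y)" using scalar_prod_abs_le s Dy by blast
    also have "\<dots> \<le> (C * mnorm D) * (mnorm D * vnorm y)"
      using ns vnorm_mult_mat_vec[OF D y] C by (intro mult_mono) auto
    finally have "\<bar>a\<bar> * \<bar>x \<bullet> (D *\<^sub>v y)\<bar> \<le> (C * mnorm D) * (mnorm D * vnorm y)" .
    moreover have "1 / 2 * \<bar>x \<bullet> (D *\<^sub>v y)\<bar> \<le> \<bar>a\<bar> * \<bar>x \<bullet> (D *\<^sub>v y)\<bar>" using a by (intro mult_right_mono) auto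
    ultimately show ?thesis by (simp add: D_def mult_ac)
  qed
  show ?thesis unfolding frechet_normal_def mem_Collect_eq
  proof (intro conjI allI impI)
    show "outer x y \<in> carrier_mat ?p l" using x y by simp
    show "X \<in> carrier_mat ?p l" using X .
    show "mrank X \<le> m" using mrank_le_of_left_null[OF X x(1) x0 null(1)] .
    fix e :: real assume e: "e > 0"
    \<comment> \<open>The first radius makes \<open>key\<close> applicable, the second absorbs one
      of the two factors \<open>mnorm (X' - X)\<close> into \<open>e\<close>; its \<open>1\<close>
      covers \<open>y = 0\<close>.\<close>
    let ?d = "min (1 / (2 * C)) (e / (2 * C * vnorm y + 1))"
    have pos: "2 * C * vnorm y + 1 > 0" using C by (simp add: add_nonneg_pos)
    show "\<exists>d>0. \<forall>X'\<in>{X \<in> carrier_mat ?p l. mrank X \<le> m}. mnorm (X' - X) < d \<longrightarrow>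
        frob (outer x y) (X' - X) \<le> e * mnorm (X' - X)"
    proof (intro exI[of _ ?d] conjI ballI impI)
      show "0 < ?d" using e C pos by simp
      fix X' assume "X' \<in> {X \<in> carrier_mat ?p l. mrank X \<le> m}" and d: "mnorm (X' - X) < ?d"
      then have X': "X' \<in> carrier_mat ?p l" "mrank X' \<le> m" by auto
      have "C * mnorm (X' - X) \<le> 1 / 2" using d C by (simp add: field_simps)
      note key[OF X' this]
      moreover have "(2 * C * vnorm y) * mnorm (X' - X) \<le> e"
      proof -
        have "mnorm (X' - X) \<le> e / (2 * C * vnorm y + 1)" using d by simp
        then have "(2 * C * vnorm y + 1) * mnorm (X' - X) \<le> e" using pos by (simp add: field_simps)
        then have "(2 * C * vnorm y) * mnorm (X' - X) + mnorm (X' - X) \<le> e" by (simp only: distrib_right mult_1)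
        then show ?thesis using mnorm_nonneg[of "X' - X"] by linarith
      qed
      then have "(2 * C * vnorm y * mnorm (X' - X)) * mnorm (X' - X) \<le> e * mnorm (X' - X)"
        by (intro mult_right_mono) auto
      moreover have "frob (outer x y) (X' - X) = x \<bullet> ((X' - X) *\<^sub>v y)"
        using frob_outer[OF x(1) y minus_carrier_mat[OF X]] .
      ultimately show "frob (outer x y) (X' - X) \<le> e * mnorm (X' - X)" by linarith
    qed
  qed
qed

text \<open>Constant sequences. The form \<open>ip\<close> is arbitrary, so the vanishing of
  self-distances has to be assumed.\<close>

lemma frechet_imp_limiting_normal:
  assumes "v \<in> frechet_normal C ip S x" "gnorm ip (x - x) = 0" "gnorm ip (v - v) = 0"
  shows "v \<in> limiting_normal C ip S x"
proof -
  have "v \<in> C" "x \<in> S" using assms(1) by (auto simp: frechet_normal_def)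
  then show ?thesis unfolding limiting_normal_def
    using assms by (intro CollectI conjI exI[of _ "\<lambda>_. x"] exI[of _ "\<lambda>_. v"]) auto
qed

lemma mnorm_diff_self [simp]: "mnorm (X - X) = 0"
proof -
  have "X - X = 0\<^sub>m (dim_row X) (dim_col X)" by auto
  then show ?thesis by (simp only: mnorm_zero)
qed

lemma vnorm_diff_self [simp]: "vnorm (v - v) = 0"
proof -
  have "v - v = 0\<^sub>v (dim_vec v)" by auto
  then show ?thesis by (simp only: vnorm_zero)
qed

text \<open>With \<open>x $ a \<noteq> 0\<close> and \<open>y $ b \<noteq> 0\<close>, take \<open>W\<close> whose columns \<open>\<pi> i \<noteq> b\<close>, restricted to the rows other than \<open>a\<close>,
  form the identity; column \<open>b\<close> and row \<open>a\<close> are then determined by \<open>W y = 0\<close> and \<open>W\<^sup>T x = 0\<close>. A left null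
  vector of \<open>X + t W\<close> vanishing at \<open>a\<close> is an eigenvector of \<open>Y\<close> for \<open>- t\<close>, so only finitely many \<open>t\<close> are bad.\<close>

lemma generic_perturbation:
  fixes X :: "real mat"
  assumes X: "X \<in> carrier_mat k l" and Xx: "X\<^sup>T *\<^sub>v x = 0\<^sub>v l" and kl: "k \<le> l"
    and x: "x \<in> carrier_vec k" "x \<noteq> 0\<^sub>v k" and y: "y \<in> carrier_vec l" "y \<noteq> 0\<^sub>v l"
  obtains W F where "W \<in> carrier_mat k l" "W\<^sup>T *\<^sub>v x = 0\<^sub>v l" "W *\<^sub>v y = 0\<^sub>v k" "finite F"
    "\<forall>t v. t \<notin> F \<longrightarrow> v \<in> carrier_vec k \<longrightarrow> (X + t \<cdot>\<^sub>m W)\<^sup>T *\<^sub>v v = 0\<^sub>v l \<longrightarrow> (\<exists>c. v = c \<cdot>\<^sub>v x)"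
proof -
  obtain a where a: "a < k" "x $ a \<noteq> 0" using x by (auto simp: vec_eq_iff)
  obtain b where b: "b < l" "y $ b \<noteq> 0" using y by (auto simp: vec_eq_iff)
  \<comment> \<open>Column \<open>b\<close> is reserved for enforcing
    \<open>W *\<^sub>v y = 0\<close>. Row \<open>b\<close> would claim it, so it is sent to column
    \<open>a\<close> instead, which is free because row \<open>a\<close> takes no part;
    \<open>k \<le> l\<close> makes \<open>a\<close> a valid column.\<close>
  define \<pi> where "\<pi> i = (if i = b then a else i)" for i
  have \<pi>: "\<pi> i < l" "\<pi> i \<noteq> b" if "i < k" "i \<noteq> a" for i using that a b kl by (auto simp: \<pi>_def)
  have \<pi>_inj: "\<pi> i = \<pi> j \<longleftrightarrow> i = j" if "i \<noteq> a" "j \<noteq> a" for i j using that by (auto simp: \<pi>_def)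
  define \<beta> where "\<beta> i j = (if j = b then - (y $ \<pi> i / y $ b) else if j = \<pi> i then 1 else 0)" for i j
  have \<beta>y: "(\<Sum>j<l. \<beta> i j * y $ j) = 0" if "i < k" "i \<noteq> a" for i
  proof -
    have "(\<Sum>j<l. \<beta> i j * y $ j) = (\<Sum>j\<in>{..<l} - {b}. \<beta> i j * y $ j) + \<beta> i b * y $ b"
      using b by (subst sum.remove[of _ b]) auto
    also have "(\<Sum>j\<in>{..<l} - {b}. \<beta> i j * y $ j) = (\<Sum>j\<in>{..<l} - {b}. if j = \<pi> i then y $ j else 0)"
      by (intro sum.cong) (auto simp: \<beta>_def)
    also have "\<dots> = y $ \<pi> i" using \<pi>[OF that] by simp
    finally show ?thesis using b by (simp add: \<beta>_def)
  qed
  define W where "W = mat k l (\<lambda>(i, j). if i = a then - (\<Sum>h\<in>{..<k} - {a}. x $ h / x $ a * \<beta> h j) else \<beta> i j)"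
  have W: "W \<in> carrier_mat k l" by (simp add: W_def)
  have "W\<^sup>T *\<^sub>v x = 0\<^sub>v l"
  proof (rule eq_vecI)
    fix j assume j: "j < dim_vec (0\<^sub>v l :: real vec)"
    have "(W\<^sup>T *\<^sub>v x) $ j = (\<Sum>i<k. W $$ (i, j) * x $ i)"
      using j x W by (simp add: scalar_prod_def atLeast0LessThan)
    also have "\<dots> = W $$ (a, j) * x $ a + (\<Sum>i\<in>{..<k} - {a}. W $$ (i, j) * x $ i)"
      using a by (subst sum.remove[of _ a]) auto
    also have "(\<Sum>i\<in>{..<k} - {a}. W $$ (i, j) * x $ i) = (\<Sum>i\<in>{..<k} - {a}. \<beta> i j * x $ i)"
      using j by (intro sum.cong) (auto simp: W_def)
    also have "W $$ (a, j) * x $ a = - (\<Sum>i\<in>{..<k} - {a}. \<beta> i j * x $ i)"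
      using j a by (auto simp: W_def sum_distrib_right intro!: sum.cong)
    finally show "(W\<^sup>T *\<^sub>v x) $ j = 0\<^sub>v l $ j" using j by simp
  qed (use W in simp)
  moreover have "W *\<^sub>v y = 0\<^sub>v k"
  proof (rule eq_vecI)
    fix i assume i: "i < dim_vec (0\<^sub>v k :: real vec)"
    have eq: "(W *\<^sub>v y) $ i = (\<Sum>j<l. W $$ (i, j) * y $ j)"
      using i y W by (simp add: scalar_prod_def atLeast0LessThan)
    have "(\<Sum>j<l. W $$ (i, j) * y $ j) = 0"
    proof (cases "i = a")
      case True
      have "(\<Sum>j<l. W $$ (i, j) * y $ j) = (\<Sum>j<l. - (\<Sum>h\<in>{..<k} - {a}. x $ h / x $ a * (\<beta> h j * y $ j)))"
        using i True by (intro sum.cong) (auto simp: W_def sum_distrib_right mult.assoc)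
      also have "\<dots> = - (\<Sum>h\<in>{..<k} - {a}. x $ h / x $ a * (\<Sum>j<l. \<beta> h j * y $ j))"
        by (simp only: sum_negf sum_distrib_left, subst sum.swap, rule refl)
      also have "\<dots> = 0" using \<beta>y by (auto intro!: sum.neutral)
      finally show ?thesis .
    next
      case False
      then have "(\<Sum>j<l. W $$ (i, j) * y $ j) = (\<Sum>j<l. \<beta> i j * y $ j)"
        using i by (intro sum.cong) (auto simp: W_def)
      then show ?thesis using \<beta>y i False by simp
    qed
    then show "(W *\<^sub>v y) $ i = 0\<^sub>v k $ i" using i eq by simp
  qed (use W in simp)
  \<comment> \<open>Row \<open>i\<close> of \<open>Y\<close> is column \<open>\<pi> i\<close> of
    \<open>X\<close>, so equation \<open>\<pi> i\<close> of the null condition for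
    \<open>X + t \<cdot>\<^sub>m W\<close> becomes row \<open>i\<close> of an eigenvalue equation;
    the zero row at \<open>a\<close> matches \<open>u $ a = 0\<close>.\<close>
  moreover define Y where "Y = mat k k (\<lambda>(i, h). if i = a then 0 else X $$ (h, \<pi> i))"
  have Y: "Y \<in> carrier_mat k k" by (simp add: Y_def)
  moreover have "\<exists>c. v = c \<cdot>\<^sub>v x"
    if t: "t \<notin> uminus ` spectrum Y" and v: "v \<in> carrier_vec k"
      and null: "(X + t \<cdot>\<^sub>m W)\<^sup>T *\<^sub>v v = 0\<^sub>v l" for t v
  proof -
    let ?Z = "X + t \<cdot>\<^sub>m W"
    have Z: "?Z \<in> carrier_mat k l" using X W by simp
    have ZT: "?Z\<^sup>T = X\<^sup>T + t \<cdot>\<^sub>m W\<^sup>T" using X W by auto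
    have "?Z\<^sup>T *\<^sub>v x = X\<^sup>T *\<^sub>v x + t \<cdot>\<^sub>v (W\<^sup>T *\<^sub>v x)"
      unfolding ZT using X W x
      by (subst add_mult_distrib_mat_vec[of _ l k]) (auto simp: smult_mat_mult_vec[of _ l k])
    then have Zx: "?Z\<^sup>T *\<^sub>v x = 0\<^sub>v l" using Xx \<open>W\<^sup>T *\<^sub>v x = 0\<^sub>v l\<close> by auto
    \<comment> \<open>Subtracting this multiple of the null vector \<open>x\<close> yields a null
      vector that vanishes at \<open>a\<close>.\<close>
    define c where "c = v $ a / x $ a"
    define u where "u = v - c \<cdot>\<^sub>v x"
    have u: "u \<in> carrier_vec k" using v x by (simp add: u_def)
    have ua: "u $ a = 0" using a v x by (simp add: u_def c_def)
    have "?Z\<^sup>T *\<^sub>v u = ?Z\<^sup>T *\<^sub>v v - c \<cdot>\<^sub>v (?Z\<^sup>T *\<^sub>v x)"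
      unfolding u_def using Z v x mult_minus_distrib_mat_vec[of "?Z\<^sup>T" l k v "c \<cdot>\<^sub>v x"]
        mult_mat_vec[of "?Z\<^sup>T" l k x c] by simp
    then have Zu: "?Z\<^sup>T *\<^sub>v u = 0\<^sub>v l" using Zx null by auto
    have "Y *\<^sub>v u = (- t) \<cdot>\<^sub>v u"
    proof (rule eq_vecI)
      fix i assume "i < dim_vec ((- t) \<cdot>\<^sub>v u)"
      then have i: "i < k" using u by simp
      show "(Y *\<^sub>v u) $ i = ((- t) \<cdot>\<^sub>v u) $ i"
      proof (cases "i = a")
        case True
        then show ?thesis using i u ua by (simp add: Y_def scalar_prod_def)
      next
        case False
        have "0 = (?Z\<^sup>T *\<^sub>v u) $ \<pi> i" using Zu \<pi>[OF i False] by simp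
        also have "\<dots> = (\<Sum>h<k. (X $$ (h, \<pi> i) + t * W $$ (h, \<pi> i)) * u $ h)"
          using \<pi>[OF i False] u Z X W by (simp add: scalar_prod_def atLeast0LessThan)
        also have "\<dots> = (\<Sum>h<k. X $$ (h, \<pi> i) * u $ h + (if h = i then t * u $ h else 0))"
        proof (rule sum.cong)
          fix h assume h: "h \<in> {..<k}"
          show "(X $$ (h, \<pi> i) + t * W $$ (h, \<pi> i)) * u $ h = X $$ (h, \<pi> i) * u $ h + (if h = i then t * u $ h else 0)"
          proof (cases "h = a")
            case True
            then show ?thesis using ua False by simp
          next
            case ha: False
            then have "W $$ (h, \<pi> i) = (if h = i then 1 else 0)"
              using \<pi>[OF i False] h \<pi>_inj[OF False ha] by (auto simp: W_def \<beta>_def)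
            then show ?thesis by (simp add: algebra_simps)
          qed
        qed simp
        also have "\<dots> = (\<Sum>h<k. X $$ (h, \<pi> i) * u $ h) + t * u $ i"
          using i by (simp add: sum.distrib)
        also have "(\<Sum>h<k. X $$ (h, \<pi> i) * u $ h) = (Y *\<^sub>v u) $ i"
          using i u False by (simp add: Y_def scalar_prod_def atLeast0LessThan)
        finally show ?thesis using i u by simp
      qed
    qed (use Y u in simp)
    then have "u = 0\<^sub>v k"
      using t Y u by (auto simp: spectrum_def eigenvalue_def eigenvector_def image_iff)
    then have "v = c \<cdot>\<^sub>v x" using v x by (auto simp: u_def vec_eq_iff)
    then show ?thesis by blast
  qed
  moreover have "finite (uminus ` spectrum Y)" using card_finite_spectrum[OF Y] by simp
  ultimately show ?thesis using that[of W "uminus ` spectrum Y"] W by blast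
qed

text \<open>At rank below \<open>m\<close> the left null space is too large for
  \<open>outer_frechet_normal\<close>. Small multiples of \<open>W\<close> shrink it to the line
  through \<open>x\<close> and keep both null relations, so one fixed outer product is a Frechet
  normal along a sequence tending to \<open>X\<close>.\<close>

lemma outer_limiting_normal:
  assumes X: "X \<in> carrier_mat (Suc m) l" and ml: "Suc m \<le> l" and x: "x \<in> carrier_vec (Suc m)" "vnorm x = 1"
    and y: "y \<in> carrier_vec l" and null: "X\<^sup>T *\<^sub>v x = 0\<^sub>v l" "X *\<^sub>v y = 0\<^sub>v (Suc m)"
  shows "outer x y \<in> limiting_normal (carrier_mat (Suc m) l) frob {X \<in> carrier_mat (Suc m) l. mrank X \<le> m} X"
    (is "_ \<in> limiting_normal ?C _ ?S _")
\<comment> \<open>The perturbation needs a nonzero entry of \<open>y\<close>; for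
  \<open>y = 0\<close> the outer product is the zero matrix, a Frechet normal at every point of the
  set.\<close>
proof (cases "y = 0\<^sub>v l")
  case True
  have x0: "x \<noteq> 0\<^sub>v (Suc m)" using x by auto
  have "frob (outer x y) (Z - X) = 0" if "Z \<in> ?S" for Z
    using frob_outer[OF x(1) y, of "Z - X"] that X x mult_mat_vec_zero[of "Z - X" "Suc m" l] by (simp add: True minus_carrier_mat)
  then have "outer x y \<in> frechet_normal ?C frob ?S X"
    unfolding frechet_normal_def using x y X mrank_le_of_left_null[OF X x(1) x0 null(1)]
    by (auto intro!: exI[of _ "1::real"])
  then show ?thesis by (rule frechet_imp_limiting_normal) auto
next
  case False
  have x0: "x \<noteq> 0\<^sub>v (Suc m)" using x by auto
  have xx: "x \<bullet> x = 1" using vnorm_sq[of x] x by simp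
  obtain W F where W: "W \<in> carrier_mat (Suc m) l" "W\<^sup>T *\<^sub>v x = 0\<^sub>v l" "W *\<^sub>v y = 0\<^sub>v (Suc m)" and F: "finite F"
    and ker: "\<forall>t v. t \<notin> F \<longrightarrow> v \<in> carrier_vec (Suc m) \<longrightarrow> (X + t \<cdot>\<^sub>m W)\<^sup>T *\<^sub>v v = 0\<^sub>v l \<longrightarrow> (\<exists>c. v = c \<cdot>\<^sub>v x)"
    by (rule generic_perturbation[OF X null(1) ml x(1) x0 y False])
  have "\<exists>t. 0 < t \<and> t < 1 / real (Suc k) \<and> t \<notin> F" for k
  proof -
    have "infinite {0<..<1 / real (Suc k)}" by (simp add: infinite_Ioo)
    then have "infinite ({0<..<1 / real (Suc k)} - F)" using F by simp
    then obtain t where "t \<in> {0<..<1 / real (Suc k)} - F" using infinite_imp_nonempty by blast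
    then show ?thesis by auto
  qed
  then obtain t where t: "\<And>k. 0 < t k" "\<And>k. t k < 1 / real (Suc k)" "\<And>k. t k \<notin> F" by metis
  define Z where "Z k = X + t k \<cdot>\<^sub>m W" for k
  have Z: "Z k \<in> carrier_mat (Suc m) l" for k using X W by (simp add: Z_def)
  have Zx: "(Z k)\<^sup>T *\<^sub>v x = 0\<^sub>v l" for k
  proof -
    have "(Z k)\<^sup>T = X\<^sup>T + t k \<cdot>\<^sub>m W\<^sup>T" using X W by (auto simp: Z_def)
    then have "(Z k)\<^sup>T *\<^sub>v x = X\<^sup>T *\<^sub>v x + t k \<cdot>\<^sub>v (W\<^sup>T *\<^sub>v x)"
      using X W x by (simp add: add_mult_distrib_mat_vec[of _ l "Suc m"] smult_mat_mult_vec[of _ l "Suc m"])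
    then show ?thesis using W null by auto
  qed
  have Zy: "Z k *\<^sub>v y = 0\<^sub>v (Suc m)" for k
  proof -
    have "Z k *\<^sub>v y = X *\<^sub>v y + t k \<cdot>\<^sub>v (W *\<^sub>v y)"
      unfolding Z_def using X W y
      by (simp add: add_mult_distrib_mat_vec[of _ "Suc m" l] smult_mat_mult_vec[of _ "Suc m" l])
    then show ?thesis using W null by auto
  qed
  have "outer x y \<in> frechet_normal ?C frob ?S (Z k)" for k
  proof (rule outer_frechet_normal[OF Z x y Zx Zy])
    fix v assume v: "v \<in> carrier_vec (Suc m)" "(Z k)\<^sup>T *\<^sub>v v = 0\<^sub>v l"
    then obtain c where "v = c \<cdot>\<^sub>v x" using ker t(3)[of k] by (auto simp: Z_def)
    then show "v = (x \<bullet> v) \<cdot>\<^sub>v x" using x xx by simp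
  qed
  moreover have "Z k \<in> ?S" for k using Z mrank_le_of_left_null[OF Z x(1) x0 Zx] by simp
  moreover have "(\<lambda>k. mnorm (Z k - X)) \<longlonglongrightarrow> 0"
  proof -
    have "t \<longlonglongrightarrow> 0"
    proof (rule tendsto_sandwich[of "\<lambda>_. 0" _ _ "\<lambda>k. 1 / real (Suc k)"])
      show "(\<lambda>k. 1 / real (Suc k)) \<longlonglongrightarrow> 0" using LIMSEQ_inverse_real_of_nat by (simp add: inverse_eq_divide)
    qed (use t in \<open>auto intro!: always_eventually less_imp_le\<close>)
    then have "(\<lambda>k. t k * mnorm W) \<longlonglongrightarrow> 0" using tendsto_mult_right[of t 0 sequentially "mnorm W"] by simp
    moreover have "mnorm (Z k - X) = t k * mnorm W" for k
    proof -
      have "Z k - X = t k \<cdot>\<^sub>m W" using X W by (auto simp: Z_def)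
      then show ?thesis using t(1)[of k] by simp
    qed
    ultimately show ?thesis by simp
  qed
  moreover have "X \<in> ?S" using X mrank_le_of_left_null[OF X x(1) x0 null(1)] by simp
  ultimately show ?thesis unfolding limiting_normal_def using x y
    by (intro CollectI conjI exI[of _ Z] exI[of _ "\<lambda>_. outer x y"]) auto
qed

section \<open>Matrices with Hankel-like structure\<close>

text \<open>From \<open>vnorm (N\<^sup>T *\<^sub>v w)\<close> squared being
  \<open>w \<bullet> (N *\<^sub>v (N\<^sup>T *\<^sub>v w))\<close>, Cauchy-Schwarz and
  \<open>lb\<close>. It bounds the minimum-norm solution of a system
  \<open>N *\<^sub>v u = z\<close> by the norm of \<open>z\<close> over \<open>c\<close>.\<close>

lemma gram_bound:
  fixes N :: "real mat"
  assumes N: "N \<in> carrier_mat k l" and c: "c > 0"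
    and lb: "\<And>v. v \<in> carrier_vec k \<Longrightarrow> c * vnorm v \<le> vnorm (N\<^sup>T *\<^sub>v v)" and w: "w \<in> carrier_vec k"
  shows "c * vnorm (N\<^sup>T *\<^sub>v w) \<le> vnorm (N *\<^sub>v (N\<^sup>T *\<^sub>v w))"
proof (cases "vnorm (N\<^sup>T *\<^sub>v w) = 0")
  case False
  have u: "N\<^sup>T *\<^sub>v w \<in> carrier_vec l" using mult_mat_vec_carrier[of "N\<^sup>T" l k w] N w by simp
  have Nu: "N *\<^sub>v (N\<^sup>T *\<^sub>v w) \<in> carrier_vec k" using N u by simp
  have "(vnorm (N\<^sup>T *\<^sub>v w))\<^sup>2 = w \<bullet> (N *\<^sub>v (N\<^sup>T *\<^sub>v w))"
    unfolding vnorm_sq using mult_mat_vec_adjoint[OF N u w] by simp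
  also have "\<dots> \<le> vnorm w * vnorm (N *\<^sub>v (N\<^sup>T *\<^sub>v w))" using scalar_prod_abs_le[OF w Nu] by linarith
  finally have "c * (vnorm (N\<^sup>T *\<^sub>v w))\<^sup>2 \<le> (c * vnorm w) * vnorm (N *\<^sub>v (N\<^sup>T *\<^sub>v w))"
    using c by simp
  also have "\<dots> \<le> vnorm (N\<^sup>T *\<^sub>v w) * vnorm (N *\<^sub>v (N\<^sup>T *\<^sub>v w))"
    using lb[OF w] by (intro mult_right_mono) auto
  finally have "vnorm (N\<^sup>T *\<^sub>v w) * (c * vnorm (N\<^sup>T *\<^sub>v w)) \<le> vnorm (N\<^sup>T *\<^sub>v w) * vnorm (N *\<^sub>v (N\<^sup>T *\<^sub>v w))"
    by (simp add: power2_eq_square mult_ac)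
  moreover have "vnorm (N\<^sup>T *\<^sub>v w) > 0" using False vnorm_nonneg[of "N\<^sup>T *\<^sub>v w"] by linarith
  ultimately show ?thesis by (simp only: mult_le_cancel_left_pos)
qed simp

lemma gram_solvable:
  fixes N :: "real mat"
  assumes N: "N \<in> carrier_mat k l"
    and inj: "\<And>v. v \<in> carrier_vec k \<Longrightarrow> N\<^sup>T *\<^sub>v v = 0\<^sub>v l \<Longrightarrow> v = 0\<^sub>v k" and z: "z \<in> carrier_vec k"
  obtains w where "w \<in> carrier_vec k" "N *\<^sub>v (N\<^sup>T *\<^sub>v w) = z"
proof -
  have NT: "N\<^sup>T \<in> carrier_mat l k" using N by simp
  obtain H where H: "H \<in> carrier_mat k k" "(N\<^sup>T\<^sup>T * N\<^sup>T) * H = 1\<^sub>m k"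
  proof (rule real_inverse_matrix)
    show "N\<^sup>T\<^sup>T * N\<^sup>T \<in> carrier_mat k k" using N by simp
    show "v = 0\<^sub>v k" if "v \<in> carrier_vec k" "(N\<^sup>T\<^sup>T * N\<^sup>T) *\<^sub>v v = 0\<^sub>v k" for v
      using gram_inj[OF NT inj that] by simp
  qed
  have Hz: "H *\<^sub>v z \<in> carrier_vec k" using H z by simp
  have "z = ((N * N\<^sup>T) * H) *\<^sub>v z" using H z by simp
  also have "\<dots> = (N * N\<^sup>T) *\<^sub>v (H *\<^sub>v z)"
    using N H z assoc_mult_mat_vec[of "N * N\<^sup>T" k k H k z] by auto
  also have "\<dots> = N *\<^sub>v (N\<^sup>T *\<^sub>v (H *\<^sub>v z))"
    using N Hz assoc_mult_mat_vec[of N k l "N\<^sup>T" k "H *\<^sub>v z"] by auto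
  finally show ?thesis using that[OF Hz] by simp
qed

text \<open>A Hankel matrix and a row of Hankel blocks differ only in the index map
  \<open>\<kappa>\<close>. Its strict growth in each argument is what the convolution argument uses,
  and it survives the passage from one block to the next.\<close>

locale hankel_structure =
  fixes d p q :: nat and \<kappa> :: "nat \<Rightarrow> nat \<Rightarrow> nat" and A :: "real vec \<Rightarrow> real mat"
  assumes A_eq: "y \<in> carrier_vec d \<Longrightarrow> A y = mat p q (\<lambda>(i, j). y $ \<kappa> i j)"
    and \<kappa>_less: "i < p \<Longrightarrow> j < q \<Longrightarrow> \<kappa> i j < d"
    and \<kappa>_mono1: "i < i' \<Longrightarrow> i' < p \<Longrightarrow> j < q \<Longrightarrow> \<kappa> i j < \<kappa> i' j"
    and \<kappa>_mono2: "j < j' \<Longrightarrow> j' < q \<Longrightarrow> i < p \<Longrightarrow> \<kappa> i j < \<kappa> i j'"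
begin

text \<open>Strict growth of \<open>\<kappa>\<close> in \<open>i\<close> leaves at most one active
  summand; the sum form makes linearity in \<open>x\<close> immediate.\<close>

definition C :: "real vec \<Rightarrow> real mat" where
  "C x = mat q d (\<lambda>(j, l). \<Sum>i<p. if \<kappa> i j = l then x $ i else 0)"

lemma C_carrier [simp]: "C x \<in> carrier_mat q d" by (simp add: C_def)
lemma CT_carrier [simp]: "(C x)\<^sup>T \<in> carrier_mat d q" by (simp add: C_def)
lemma C_dim [simp]: "dim_row (C x) = q" "dim_col (C x) = d" by (simp_all add: C_def)
lemma C_vec [simp]: "y \<in> carrier_vec d \<Longrightarrow> C x *\<^sub>v y \<in> carrier_vec q"
  by (rule mult_mat_vec_carrier[OF C_carrier])
lemma CT_vec [simp]: "w \<in> carrier_vec q \<Longrightarrow> (C x)\<^sup>T *\<^sub>v w \<in> carrier_vec d"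
  by (rule mult_mat_vec_carrier[OF CT_carrier])
lemma A_carrier [simp]: "y \<in> carrier_vec d \<Longrightarrow> A y \<in> carrier_mat p q" by (simp add: A_eq)
lemma A_vec [simp]: "y \<in> carrier_vec d \<Longrightarrow> w \<in> carrier_vec q \<Longrightarrow> A y *\<^sub>v w \<in> carrier_vec p"
  by (rule mult_mat_vec_carrier[OF A_carrier])

lemma C_mult:
  assumes y: "y \<in> carrier_vec d" and x: "x \<in> carrier_vec p"
  shows "C x *\<^sub>v y = (A y)\<^sup>T *\<^sub>v x"
proof (rule eq_vecI)
  fix j assume "j < dim_vec ((A y)\<^sup>T *\<^sub>v x)"
  then have j: "j < q" using y by (simp add: A_eq)
  have "(C x *\<^sub>v y) $ j = (\<Sum>l<d. (\<Sum>i<p. if \<kappa> i j = l then x $ i else 0) * y $ l)"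
    using j y by (simp add: C_def scalar_prod_def atLeast0LessThan)
  also have "\<dots> = (\<Sum>l<d. \<Sum>i<p. if \<kappa> i j = l then x $ i * y $ l else 0)"
    by (simp add: sum_distrib_right if_distrib[of "\<lambda>u. u * _"] cong: if_cong)
  also have "\<dots> = (\<Sum>i<p. \<Sum>l<d. if \<kappa> i j = l then x $ i * y $ l else 0)" by (rule sum.swap)
  also have "\<dots> = (\<Sum>i<p. x $ i * y $ \<kappa> i j)" using \<kappa>_less j by (intro sum.cong) auto
  also have "\<dots> = ((A y)\<^sup>T *\<^sub>v x) $ j"
    using j y x by (simp add: A_eq scalar_prod_def atLeast0LessThan mult.commute)
  finally show "(C x *\<^sub>v y) $ j = ((A y)\<^sup>T *\<^sub>v x) $ j" .
qed (use y in \<open>simp add: A_eq\<close>)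

lemma C_diff:
  assumes "x \<in> carrier_vec p" "x' \<in> carrier_vec p"
  shows "C (x - x') = C x - C x'"
proof (rule eq_matI)
  fix j l assume "j < dim_row (C x - C x')" "l < dim_col (C x - C x')"
  then have jl: "j < q" "l < d" by auto
  have "(\<Sum>i<p. if \<kappa> i j = l then (x - x') $ i else 0)
      = (\<Sum>i<p. (if \<kappa> i j = l then x $ i else 0) - (if \<kappa> i j = l then x' $ i else 0))"
    using assms by (intro sum.cong) auto
  then show "C (x - x') $$ (j, l) = (C x - C x') $$ (j, l)"
    using jl by (simp add: C_def sum_subtractf)
qed auto

lemma C_diff_mult:
  assumes "x \<in> carrier_vec p" "x' \<in> carrier_vec p" "y \<in> carrier_vec d"
  shows "C (x - x') *\<^sub>v y = C x *\<^sub>v y - C x' *\<^sub>v y"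
  unfolding C_diff[OF assms(1,2)] using assms by (intro minus_mult_distrib_mat_vec) auto

lemma CT_diff_mult:
  assumes "x \<in> carrier_vec p" "x' \<in> carrier_vec p" "w \<in> carrier_vec q"
  shows "(C (x - x'))\<^sup>T *\<^sub>v w = (C x)\<^sup>T *\<^sub>v w - (C x')\<^sup>T *\<^sub>v w"
proof -
  have "(C (x - x'))\<^sup>T = (C x)\<^sup>T - (C x')\<^sup>T"
    unfolding C_diff[OF assms(1,2)] by (rule transpose_minus) auto
  then show ?thesis using assms minus_mult_distrib_mat_vec[of "(C x)\<^sup>T" d q "(C x')\<^sup>T" w] by simp
qed

lemma A_diff:
  assumes "y \<in> carrier_vec d" "y' \<in> carrier_vec d"
  shows "A (y - y') = A y - A y'"
  using assms \<kappa>_less by (auto simp: A_eq)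

text \<open>Both sides are one trilinear form in \<open>x\<close>, \<open>y\<close>,
  \<open>w\<close>: read in \<open>y\<close> it gives the constraint, read in \<open>x\<close> the
  gradient \<open>A y *\<^sub>v w\<close>. For feasible \<open>y\<close> it says that this gradient
  is orthogonal to \<open>x\<close>.\<close>

lemma bilinear:
  assumes "x \<in> carrier_vec p" "y \<in> carrier_vec d" "w \<in> carrier_vec q"
  shows "w \<bullet> (C x *\<^sub>v y) = (A y *\<^sub>v w) \<bullet> x"
proof -
  have "(A y)\<^sup>T \<in> carrier_mat q p" using assms by simp
  from mult_mat_vec_adjoint[OF this assms(1) assms(3)] show ?thesis
    using C_mult[OF assms(2,1)] by simp
qed

text \<open>One constant for both matrices: \<open>q * d * p\<close> serves \<open>C\<close>
  (\<open>p\<close> summands in each of \<open>q * d\<close> entries), \<open>p * q\<close> serves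
  \<open>A\<close>, and the \<open>1\<close> permits division.\<close>

definition K :: real where "K = real (q * d * p + p * q) + 1"

lemma K_pos: "K > 0" by (simp add: K_def add_nonneg_pos)

lemma C_bound: "x \<in> carrier_vec p \<Longrightarrow> mnorm (C x) \<le> K * vnorm x"
proof -
  assume x: "x \<in> carrier_vec p"
  have "mnorm (C x) \<le> real (q * d) * (real p * vnorm x)"
    using mnorm_le_entries[of "C x" "real p * vnorm x"]
  proof (rule order.trans)
    fix j l assume "j < dim_row (C x)" "l < dim_col (C x)"
    then have "\<bar>C x $$ (j, l)\<bar> \<le> (\<Sum>i<p. \<bar>if \<kappa> i j = l then x $ i else 0\<bar>)"
      by (simp add: C_def sum_abs)
    also have "\<dots> \<le> (\<Sum>i<p. vnorm x)"
      using abs_index_le_vnorm[of _ x] x by (intro sum_mono) auto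
    finally show "\<bar>C x $$ (j, l)\<bar> \<le> real p * vnorm x" by simp
  qed simp
  also have "\<dots> \<le> K * vnorm x"
    unfolding mult.assoc[symmetric] by (intro mult_right_mono) (simp_all add: K_def)
  finally show ?thesis .
qed

lemma A_bound: "y \<in> carrier_vec d \<Longrightarrow> mnorm (A y) \<le> K * vnorm y"
proof -
  assume y: "y \<in> carrier_vec d"
  have "mnorm (A y) \<le> real (dim_row (A y) * dim_col (A y)) * vnorm y"
    using y \<kappa>_less abs_index_le_vnorm[of _ y] by (intro mnorm_le_entries) (auto simp: A_eq)
  also have "\<dots> \<le> K * vnorm y"
    using y by (intro mult_right_mono) (simp_all add: K_def A_eq)
  finally show ?thesis .
qed

lemma C_mult_bound:
  "x \<in> carrier_vec p \<Longrightarrow> y \<in> carrier_vec d \<Longrightarrow> vnorm (C x *\<^sub>v y) \<le> K * vnorm x * vnorm y"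
  using vnorm_mult_mat_vec[OF C_carrier, of y x] mult_right_mono[OF C_bound, of x "vnorm y"] by simp

lemma CT_mult_bound:
  "x \<in> carrier_vec p \<Longrightarrow> w \<in> carrier_vec q \<Longrightarrow> vnorm ((C x)\<^sup>T *\<^sub>v w) \<le> K * vnorm x * vnorm w"
  using vnorm_mult_mat_vec[OF CT_carrier, of w x] mult_right_mono[OF C_bound, of x "vnorm w"] by simp

lemma A_mult_bound:
  "y \<in> carrier_vec d \<Longrightarrow> w \<in> carrier_vec q \<Longrightarrow> vnorm (A y *\<^sub>v w) \<le> K * vnorm y * vnorm w"
  using vnorm_mult_mat_vec[OF A_carrier, of y w] mult_right_mono[OF A_bound, of y "vnorm w"] by simp

text \<open>\<open>(C x)\<^sup>T w\<close> is a (block) convolution of \<open>x\<close> and \<open>w\<close>; the product of their first nonzero entries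
  is one of its entries.\<close>

lemma CT_inj:
  assumes x: "x \<in> carrier_vec p" "x \<noteq> 0\<^sub>v p" and w: "w \<in> carrier_vec q" and 0: "(C x)\<^sup>T *\<^sub>v w = 0\<^sub>v d"
  shows "w = 0\<^sub>v q"
proof (rule ccontr)
  assume "w \<noteq> 0\<^sub>v q"
  then obtain j where "j < q \<and> w $ j \<noteq> 0" using w by (auto simp: vec_eq_iff)
  then obtain j0 where j0: "j0 < q" "w $ j0 \<noteq> 0" and j0_min: "\<And>j. j < j0 \<Longrightarrow> w $ j = 0"
    using exists_least_iff[of "\<lambda>j. j < q \<and> w $ j \<noteq> 0"] by (metis order.strict_trans)
  obtain i where "i < p \<and> x $ i \<noteq> 0" using x by (auto simp: vec_eq_iff)
  then obtain i0 where i0: "i0 < p" "x $ i0 \<noteq> 0" and i0_min: "\<And>i. i < i0 \<Longrightarrow> x $ i = 0"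
    using exists_least_iff[of "\<lambda>i. i < p \<and> x $ i \<noteq> 0"] by (metis order.strict_trans)
  have l: "\<kappa> i0 j0 < d" using \<kappa>_less i0 j0 by blast
  have "(if \<kappa> i j = \<kappa> i0 j0 then x $ i * w $ j else 0) = (if i = i0 \<and> j = j0 then x $ i * w $ j else 0)"
    if "i < p" "j < q" for i j
  proof (cases "i < i0 \<or> j < j0")
    case True
    then show ?thesis using i0_min j0_min by auto
  next
    case False
    \<comment> \<open>Going from \<open>(i0, j0)\<close> along row \<open>i0\<close> to column
      \<open>j\<close> and then down to row \<open>i\<close> raises \<open>\<kappa>\<close> strictly
      unless neither index changes.\<close>
    have "\<kappa> i0 j0 \<le> \<kappa> i0 j" using False \<kappa>_mono2[of j0 j i0] that i0 by (cases "j = j0") auto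
    moreover have "\<kappa> i0 j \<le> \<kappa> i j" using False \<kappa>_mono1[of i0 i j] that by (cases "i = i0") auto
    moreover have "\<kappa> i0 j0 < \<kappa> i0 j" if "j \<noteq> j0" using False \<kappa>_mono2[of j0 j i0] that \<open>j < q\<close> i0 by auto
    moreover have "\<kappa> i0 j < \<kappa> i j" if "i \<noteq> i0" using False \<kappa>_mono1[of i0 i j] that \<open>j < q\<close> \<open>i < p\<close> by auto
    ultimately have "\<kappa> i j = \<kappa> i0 j0 \<longleftrightarrow> i = i0 \<and> j = j0" by (cases "j = j0"; cases "i = i0") auto
    then show ?thesis by simp
  qed
  note eq = this
  have "((C x)\<^sup>T *\<^sub>v w) $ \<kappa> i0 j0 = (\<Sum>j<q. (\<Sum>i<p. if \<kappa> i j = \<kappa> i0 j0 then x $ i else 0) * w $ j)"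
    using l w by (simp add: C_def scalar_prod_def atLeast0LessThan)
  also have "\<dots> = (\<Sum>j<q. \<Sum>i<p. if \<kappa> i j = \<kappa> i0 j0 then x $ i * w $ j else 0)"
    by (simp add: sum_distrib_right if_distrib[of "\<lambda>u. u * _"] cong: if_cong)
  also have "\<dots> = (\<Sum>j<q. \<Sum>i<p. if i = i0 \<and> j = j0 then x $ i * w $ j else 0)"
    using eq by (intro sum.cong) auto
  also have "\<dots> = (\<Sum>j<q. if j = j0 then x $ i0 * w $ j else 0)"
    using i0 by (intro sum.cong) auto
  also have "\<dots> = x $ i0 * w $ j0" using j0 by simp
  finally show False using 0 l i0 j0 by simp
qed

lemma CT_lower_bound:
  assumes x: "x \<in> carrier_vec p" "x \<noteq> 0\<^sub>v p"
  obtains c where "c > 0" "\<forall>x'\<in>carrier_vec p. vnorm (x' - x) < c \<longrightarrow> (\<forall>w\<in>carrier_vec q. c * vnorm w \<le> vnorm ((C x')\<^sup>T *\<^sub>v w))"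
proof -
  obtain b where b: "b > 0" "\<And>w. w \<in> carrier_vec q \<Longrightarrow> b * vnorm w \<le> vnorm ((C x)\<^sup>T *\<^sub>v w)"
    using injective_lower_bound[OF CT_carrier CT_inj[OF x]] by blast
  \<comment> \<open>\<open>c\<close> serves as radius and as constant: within
    \<open>b / (2 * K)\<close> of \<open>x\<close> the perturbation costs at most half of
    \<open>b\<close>, and the other half remains.\<close>
  define c where "c = min (b / 2) (b / (2 * K))"
  have c: "c > 0" "c \<le> b / 2" "c \<le> b / (2 * K)" using b(1) K_pos by (simp_all add: c_def)
  have "c * vnorm w \<le> vnorm ((C x')\<^sup>T *\<^sub>v w)"
    if x': "x' \<in> carrier_vec p" and small: "vnorm (x' - x) < c" and w: "w \<in> carrier_vec q" for x' w
  proof -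
    have "(C x)\<^sup>T *\<^sub>v w = (C x')\<^sup>T *\<^sub>v w - (C (x' - x))\<^sup>T *\<^sub>v w"
      using CT_diff_mult[OF x' x(1) w] w CT_vec[OF w, of x] CT_vec[OF w, of x'] by auto
    then have "vnorm ((C x)\<^sup>T *\<^sub>v w) \<le> vnorm ((C x')\<^sup>T *\<^sub>v w) + vnorm ((C (x' - x))\<^sup>T *\<^sub>v w)"
      using vnorm_diff_triangle[OF CT_vec[OF w, of x'] CT_vec[OF w, of "x' - x"]] by simp
    moreover have "vnorm ((C (x' - x))\<^sup>T *\<^sub>v w) \<le> K * vnorm (x' - x) * vnorm w"
      using CT_mult_bound[of "x' - x"] x x' w by simp
    moreover have "K * vnorm (x' - x) \<le> b / 2"
    proof -
      have "vnorm (x' - x) \<le> b / (2 * K)" using small c(3) by linarith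
      then show ?thesis using K_pos by (simp add: field_simps)
    qed
    then have "K * vnorm (x' - x) * vnorm w \<le> b / 2 * vnorm w" by (intro mult_right_mono) auto
    moreover have "c * vnorm w \<le> b / 2 * vnorm w" using c(2) by (intro mult_right_mono) auto
    ultimately show ?thesis using b(2)[OF w] by linarith
  qed
  then show ?thesis using that c(1) by blast
qed

end

section \<open>The value function\<close>

locale hankel_approximation = hankel_structure +
  fixes yh :: "real vec"
  assumes yh [simp]: "yh \<in> carrier_vec d"
begin

lemma yh_dim [simp]: "dim_vec yh = d" using yh by (simp only: carrier_vecD)

text \<open>The Lagrange system of the inner problem: \<open>w\<close> is the multiplier of the
  constraint \<open>C x *\<^sub>v y = 0\<^sub>v q\<close>, and the equation for \<open>y\<close> is
  stationarity of the Lagrangian.\<close>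

definition kkt :: "real vec \<Rightarrow> real vec \<Rightarrow> real vec \<Rightarrow> bool" where
  "kkt x y w \<longleftrightarrow> x \<in> carrier_vec p \<and> y \<in> carrier_vec d \<and> w \<in> carrier_vec q \<and>
     y = yh - (C x)\<^sup>T *\<^sub>v w \<and> C x *\<^sub>v y = 0\<^sub>v q"

lemma kkt_exists:
  assumes x: "x \<in> carrier_vec p" "x \<noteq> 0\<^sub>v p"
  obtains y w where "kkt x y w"
proof -
  obtain w where w: "w \<in> carrier_vec q" "C x *\<^sub>v ((C x)\<^sup>T *\<^sub>v w) = C x *\<^sub>v yh"
    by (rule gram_solvable[OF C_carrier CT_inj[OF x] C_vec[OF yh]]) simp_all
  have "C x *\<^sub>v (yh - (C x)\<^sup>T *\<^sub>v w) = C x *\<^sub>v yh - C x *\<^sub>v ((C x)\<^sup>T *\<^sub>v w)"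
    using w by (intro mult_minus_distrib_mat_vec) auto
  then have "C x *\<^sub>v (yh - (C x)\<^sup>T *\<^sub>v w) = 0\<^sub>v q" using w C_vec[OF yh, of x] by auto
  then have "kkt x (yh - (C x)\<^sup>T *\<^sub>v w) w" using x w by (simp add: kkt_def)
  then show ?thesis using that by blast
qed

lemma sq_norm_add:
  assumes "u \<in> carrier_vec k" "v \<in> carrier_vec k"
  shows "(vnorm (u + v))\<^sup>2 = (vnorm u)\<^sup>2 + 2 * (u \<bullet> v) + (vnorm v)\<^sup>2"
  using assms by (simp add: vnorm_sq add_scalar_prod_distrib[of _ k] scalar_prod_add_distrib[of _ k]
      comm_scalar_prod[of v k u])

text \<open>Completing the square with \<open>y - yh\<close> replaced by the multiplier term. As
  \<open>y'\<close> may be infeasible for \<open>x\<close>, it gives both optimality (constraint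
  term zero) and the change of value for a \<open>y'\<close> feasible at a neighbouring
  \<open>x'\<close>.\<close>

lemma kkt_expand:
  assumes kkt: "kkt x y w" and y': "y' \<in> carrier_vec d"
  shows "(vnorm (y' - yh))\<^sup>2 = (vnorm (y - yh))\<^sup>2 - 2 * (w \<bullet> (C x *\<^sub>v y')) + (vnorm (y' - y))\<^sup>2"
proof -
  have k: "x \<in> carrier_vec p" "y \<in> carrier_vec d" "w \<in> carrier_vec q" "y = yh - (C x)\<^sup>T *\<^sub>v w" "C x *\<^sub>v y = 0\<^sub>v q"
    using kkt by (auto simp: kkt_def)
  have CTw: "(C x)\<^sup>T *\<^sub>v w \<in> carrier_vec d" using k by simp
  have "y' - yh = (y - yh) + (y' - y)" using y' k(2) by auto
  then have "(vnorm (y' - yh))\<^sup>2 = (vnorm (y - yh))\<^sup>2 + 2 * ((y - yh) \<bullet> (y' - y)) + (vnorm (y' - y))\<^sup>2"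
    using sq_norm_add[of "y - yh" d "y' - y"] y' k(2) by simp
  moreover have "(y - yh) \<bullet> (y' - y) = - (w \<bullet> (C x *\<^sub>v y'))"
  proof -
    have "y - yh = - ((C x)\<^sup>T *\<^sub>v w)" using CTw by (auto simp: k(4))
    then have "(y - yh) \<bullet> (y' - y) = - (((C x)\<^sup>T *\<^sub>v w) \<bullet> (y' - y))"
      using scalar_prod_uminus_left[of "(C x)\<^sup>T *\<^sub>v w" "y' - y"] CTw y' k(2) by simp
    also have "((C x)\<^sup>T *\<^sub>v w) \<bullet> (y' - y) = w \<bullet> (C x *\<^sub>v (y' - y))"
      using mult_mat_vec_adjoint[OF C_carrier _ k(3)] y' k(2) by simp
    also have "C x *\<^sub>v (y' - y) = C x *\<^sub>v y' - C x *\<^sub>v y"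
      using y' k(2) by (intro mult_minus_distrib_mat_vec) auto
    also have "\<dots> = C x *\<^sub>v y'" using k(5) C_vec[OF y', of x] by auto
    finally show ?thesis .
  qed
  ultimately show ?thesis by simp
qed

lemma feasible_iff:
  assumes R: "R \<in> carrier_mat 1 p" and y: "y \<in> carrier_vec d"
  shows "R * A y = 0\<^sub>m 1 q \<longleftrightarrow> C (row R 0) *\<^sub>v y = 0\<^sub>v q"
proof -
  have r: "row R 0 \<in> carrier_vec p" using R by (auto simp: row_def)
  have "R * A y = 0\<^sub>m 1 q \<longleftrightarrow> (\<forall>j<q. row R 0 \<bullet> col (A y) j = 0)"
    using R y by (auto simp: mat_eq_iff A_eq)
  also have "\<dots> \<longleftrightarrow> (\<forall>j<q. col (A y) j \<bullet> row R 0 = 0)"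
    using y r by (metis A_carrier carrier_matD(1) carrier_vecI comm_scalar_prod dim_col)
  also have "\<dots> \<longleftrightarrow> (A y)\<^sup>T *\<^sub>v row R 0 = 0\<^sub>v q"
    using y by (auto simp: vec_eq_iff A_eq)
  finally show ?thesis using C_mult[OF y r] by simp
qed

lemma Psi_le:
  assumes R: "R \<in> carrier_mat 1 p" and y: "y \<in> carrier_vec d" "C (row R 0) *\<^sub>v y = 0\<^sub>v q"
  shows "Psi d q A yh R \<le> 1 / 2 * (vnorm (y - yh))\<^sup>2"
  unfolding Psi_def
proof (rule cInf_lower)
  show "1 / 2 * (vnorm (y - yh))\<^sup>2 \<in> {1 / 2 * (vnorm (y - yh))\<^sup>2 |y. y \<in> carrier_vec d \<and> R * A y = 0\<^sub>m 1 q}"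
    using feasible_iff[OF R] y by blast
  show "bdd_below {1 / 2 * (vnorm (y - yh))\<^sup>2 |y. y \<in> carrier_vec d \<and> R * A y = 0\<^sub>m 1 q}"
  proof (rule bdd_belowI)
    fix t assume "t \<in> {1 / 2 * (vnorm (y - yh))\<^sup>2 |y. y \<in> carrier_vec d \<and> R * A y = 0\<^sub>m 1 q}"
    then obtain y where "t = 1 / 2 * (vnorm (y - yh))\<^sup>2" by blast
    then show "0 \<le> t" using zero_le_power2[of "vnorm (y - yh)"] by linarith
  qed
qed

lemma Psi_kkt:
  assumes R: "R \<in> carrier_mat 1 p" and kkt: "kkt (row R 0) y w"
  shows "Psi d q A yh R = 1 / 2 * (vnorm (y - yh))\<^sup>2"
  unfolding Psi_def
proof (rule cInf_eq_minimum)
  have k: "y \<in> carrier_vec d" "w \<in> carrier_vec q" "C (row R 0) *\<^sub>v y = 0\<^sub>v q" using kkt by (auto simp: kkt_def)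
  show "1 / 2 * (vnorm (y - yh))\<^sup>2 \<in> {1 / 2 * (vnorm (y - yh))\<^sup>2 |y. y \<in> carrier_vec d \<and> R * A y = 0\<^sub>m 1 q}"
    using feasible_iff[OF R] k by blast
  fix t assume "t \<in> {1 / 2 * (vnorm (y - yh))\<^sup>2 |y. y \<in> carrier_vec d \<and> R * A y = 0\<^sub>m 1 q}"
  then obtain y' where t: "t = 1 / 2 * (vnorm (y' - yh))\<^sup>2" and y': "y' \<in> carrier_vec d" "C (row R 0) *\<^sub>v y' = 0\<^sub>v q"
    using feasible_iff[OF R] by auto
  show "1 / 2 * (vnorm (y - yh))\<^sup>2 \<le> t" using kkt_expand[OF kkt y'(1)] y'(2) k by (simp add: t)
qed

text \<open>Equal values leave only the square of \<open>vnorm (y' - y)\<close> in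
  \<open>kkt_expand\<close>. This supplies the given minimizer with a multiplier.\<close>

lemma kkt_unique:
  assumes R: "R \<in> carrier_mat 1 p" and kkt: "kkt (row R 0) y w"
    and y': "y' \<in> carrier_vec d" "R * A y' = 0\<^sub>m 1 q" "1 / 2 * (vnorm (y' - yh))\<^sup>2 = Psi d q A yh R"
  shows "y' = y"
proof -
  have k: "y \<in> carrier_vec d" "w \<in> carrier_vec q" using kkt by (auto simp: kkt_def)
  have "C (row R 0) *\<^sub>v y' = 0\<^sub>v q" using feasible_iff[OF R y'(1)] y'(2) by simp
  then have "(vnorm (y' - y))\<^sup>2 = 0"
    using kkt_expand[OF kkt y'(1)] y'(3) Psi_kkt[OF R kkt] k by simp
  then have "y' - y = 0\<^sub>v d" using vnorm_eq_0[of "y' - y" d] y'(1) k by simp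
  then show ?thesis using y'(1) k by (auto simp: vec_eq_iff)
qed

text \<open>First-order upper model of \<open>Psi\<close>: the minimizer \<open>y\<close> at \<open>x\<close> is corrected to a point feasible for
  \<open>x'\<close> by the minimum-norm solution of \<open>C x' u = C x' y\<close>.\<close>

lemma feasible_upper_model:
  assumes kkt: "kkt x y w" and x0: "x \<noteq> 0\<^sub>v p"
  obtains \<delta> M where "\<delta> > 0" "M \<ge> 0"
    "\<forall>x'\<in>carrier_vec p. vnorm (x' - x) < \<delta> \<longrightarrow> (\<exists>y'\<in>carrier_vec d. C x' *\<^sub>v y' = 0\<^sub>v q \<and>
      1 / 2 * (vnorm (y' - yh))\<^sup>2 \<le> 1 / 2 * (vnorm (y - yh))\<^sup>2 + (A y *\<^sub>v w) \<bullet> (x' - x) + M * (vnorm (x' - x))\<^sup>2)"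
proof -
  have k: "x \<in> carrier_vec p" "y \<in> carrier_vec d" "w \<in> carrier_vec q" "y = yh - (C x)\<^sup>T *\<^sub>v w" "C x *\<^sub>v y = 0\<^sub>v q"
    using kkt by (auto simp: kkt_def)
  obtain c where c: "c > 0" and lb: "\<forall>x'\<in>carrier_vec p. vnorm (x' - x) < c \<longrightarrow> (\<forall>w\<in>carrier_vec q. c * vnorm w \<le> vnorm ((C x')\<^sup>T *\<^sub>v w))"
    by (rule CT_lower_bound[OF k(1) x0])
  \<comment> \<open>Lipschitz constant of the correction:
    \<open>c * vnorm u \<le> vnorm (C h *\<^sub>v y)\<close>, which is at most
    \<open>K * vnorm h * vnorm y\<close>.\<close>
  define L where "L = K * vnorm y / c"
  have L: "L \<ge> 0" using c K_pos by (simp add: L_def)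
  \<comment> \<open>The first summand bounds the mixed term
    \<open>w \<bullet> (C h *\<^sub>v u)\<close>, the second is half the squared norm of
    \<open>u\<close>.\<close>
  define M where "M = K * vnorm w * L + L\<^sup>2 / 2"
  have M: "M \<ge> 0" using L K_pos by (simp add: M_def)
  have "\<exists>y'\<in>carrier_vec d. C x' *\<^sub>v y' = 0\<^sub>v q \<and>
      1 / 2 * (vnorm (y' - yh))\<^sup>2 \<le> 1 / 2 * (vnorm (y - yh))\<^sup>2 + (A y *\<^sub>v w) \<bullet> (x' - x) + M * (vnorm (x' - x))\<^sup>2"
    if x': "x' \<in> carrier_vec p" and small: "vnorm (x' - x) < c" for x'
  proof -
    define h where "h = x' - x"
    have h: "h \<in> carrier_vec p" using x' k(1) by (simp add: h_def)
    have lb': "c * vnorm v \<le> vnorm ((C x')\<^sup>T *\<^sub>v v)" if "v \<in> carrier_vec q" for v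
      using lb x' small that by blast
    have inj: "v = 0\<^sub>v q" if "v \<in> carrier_vec q" "(C x')\<^sup>T *\<^sub>v v = 0\<^sub>v d" for v
    proof -
      have "c * vnorm v \<le> 0" using lb'[OF that(1)] that(2) by simp
      then have "vnorm v \<le> 0" using c by (simp add: mult_le_0_iff)
      then show ?thesis using vnorm_eq_0[of v q] vnorm_nonneg[of v] that(1) by simp
    qed
    obtain v where v: "v \<in> carrier_vec q" "C x' *\<^sub>v ((C x')\<^sup>T *\<^sub>v v) = C x' *\<^sub>v y"
      by (rule gram_solvable[OF C_carrier inj C_vec[OF k(2)]]) simp_all
    define u where "u = (C x')\<^sup>T *\<^sub>v v"
    have u: "u \<in> carrier_vec d" using v by (simp add: u_def)
    have Cu: "C x' *\<^sub>v u = C h *\<^sub>v y"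
    proof -
      have "C h *\<^sub>v y = C x' *\<^sub>v y - C x *\<^sub>v y" unfolding h_def using C_diff_mult[OF x' k(1,2)] .
      then show ?thesis using v(2) k(5) C_vec[OF k(2), of x'] by (auto simp: u_def)
    qed
    have "c * vnorm u \<le> vnorm (C h *\<^sub>v y)"
      using gram_bound[OF C_carrier c lb' v(1)] Cu by (simp add: u_def)
    also have "\<dots> \<le> K * vnorm h * vnorm y" using C_mult_bound h k(2) by blast
    finally have nu: "vnorm u \<le> L * vnorm h" using c by (simp add: L_def field_simps)
    define y' where "y' = y - u"
    have y': "y' \<in> carrier_vec d" using k(2) u by (simp add: y'_def)
    have Cx'y': "C x' *\<^sub>v y' = 0\<^sub>v q"
    proof -
      have "C x' *\<^sub>v y' = C x' *\<^sub>v y - C x' *\<^sub>v u"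
        unfolding y'_def using k(2) u by (intro mult_minus_distrib_mat_vec) auto
      then show ?thesis using v(2) C_vec[OF k(2), of x'] by (auto simp: u_def)
    qed
    have "vnorm (y' - y) = vnorm u"
    proof -
      have "y' - y = - u" using k(2) u by (auto simp: y'_def)
      then show ?thesis by simp
    qed
    \<comment> \<open>As \<open>y'\<close> is feasible for \<open>x'\<close>,
      \<open>C x *\<^sub>v y'\<close> equals \<open>- (C h *\<^sub>v y')\<close>; inserting
      \<open>y' = y - u\<close> separates the first-order term from one of second order.\<close>
    moreover have "w \<bullet> (C x *\<^sub>v y') = - ((A y *\<^sub>v w) \<bullet> h) + w \<bullet> (C h *\<^sub>v u)"
    proof -
      have "C h *\<^sub>v y' = C x' *\<^sub>v y' - C x *\<^sub>v y'" unfolding h_def using C_diff_mult[OF x' k(1) y'] .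
      then have "C x *\<^sub>v y' = - (C h *\<^sub>v y')" using Cx'y' C_vec[OF y', of x] by auto
      moreover have "C h *\<^sub>v y' = C h *\<^sub>v y - C h *\<^sub>v u"
        unfolding y'_def using k(2) u by (intro mult_minus_distrib_mat_vec) auto
      ultimately have "w \<bullet> (C x *\<^sub>v y') = - (w \<bullet> (C h *\<^sub>v y)) + w \<bullet> (C h *\<^sub>v u)"
        using k(2,3) u scalar_prod_uminus_right[of w "C h *\<^sub>v y - C h *\<^sub>v u"]
          scalar_prod_minus_distrib[of w q "C h *\<^sub>v y" "C h *\<^sub>v u"] by simp
      then show ?thesis using bilinear[OF h k(2,3)] by simp
    qed
    moreover have "- (w \<bullet> (C h *\<^sub>v u)) \<le> K * vnorm w * L * (vnorm h)\<^sup>2"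
    proof -
      have "\<bar>w \<bullet> (C h *\<^sub>v u)\<bar> \<le> vnorm w * vnorm (C h *\<^sub>v u)" using scalar_prod_abs_le k(3) C_vec[OF u] by blast
      also have "\<dots> \<le> vnorm w * (K * vnorm h * (L * vnorm h))"
      proof (intro mult_left_mono)
        have "K * vnorm h * vnorm u \<le> K * vnorm h * (L * vnorm h)"
          using nu K_pos by (intro mult_left_mono) auto
        then show "vnorm (C h *\<^sub>v u) \<le> K * vnorm h * (L * vnorm h)" using C_mult_bound[OF h u] by linarith
      qed simp
      finally show ?thesis by (simp add: power2_eq_square mult_ac abs_le_iff)
    qed
    moreover have "(vnorm u)\<^sup>2 \<le> L\<^sup>2 * (vnorm h)\<^sup>2"
      using power_mono[OF nu, of 2] by (simp add: power_mult_distrib)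
    ultimately have "1 / 2 * (vnorm (y' - yh))\<^sup>2 \<le> 1 / 2 * (vnorm (y - yh))\<^sup>2 + (A y *\<^sub>v w) \<bullet> h + M * (vnorm h)\<^sup>2"
      using kkt_expand[OF kkt y'] by (simp add: M_def algebra_simps)
    then show ?thesis using y' Cx'y' unfolding h_def by blast
  qed
  then show ?thesis using that[OF c M] by blast
qed

end

section \<open>First-order conditions on the unit sphere\<close>

text \<open>Test the first-order condition along \<open>x' = (x + t s) / \<parallel>x + t s\<parallel>\<close>, where \<open>s\<close> is the tangential
  part of \<open>v - g\<close>.\<close>

lemma sphere_first_order:
  assumes x: "x \<in> carrier_vec k" "x \<bullet> x = 1" and g: "g \<in> carrier_vec k" "g \<bullet> x = 0" and v: "v \<in> carrier_vec k"
    and M: "M \<ge> 0"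
    and ineq: "\<And>\<epsilon>. \<epsilon> > 0 \<Longrightarrow> \<exists>\<delta>>0. \<forall>x'\<in>carrier_vec k. x' \<bullet> x' = 1 \<longrightarrow> vnorm (x' - x) < \<delta> \<longrightarrow>
      v \<bullet> (x' - x) - \<epsilon> * vnorm (x' - x) \<le> g \<bullet> (x' - x) + M * (vnorm (x' - x))\<^sup>2"
  shows "g = v - (v \<bullet> x) \<cdot>\<^sub>v x"
proof -
  define a where "a = v \<bullet> x"
  define s where "s = v - g - a \<cdot>\<^sub>v x"
  define r where "r = vnorm s"
  have s: "s \<in> carrier_vec k" using x g v by (simp add: s_def)
  have xs: "s \<bullet> x = 0"
    unfolding s_def using x g v by (simp add: minus_scalar_prod_distrib[of _ k] a_def)
  \<comment> \<open>The slope of \<open>v - g\<close> along \<open>s\<close> is the squared length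
    of \<open>s\<close>, so a nonzero \<open>s\<close> contradicts the first-order
    inequality.\<close>
  have es: "v \<bullet> s - g \<bullet> s = r\<^sup>2"
  proof -
    have "r\<^sup>2 = s \<bullet> s" by (simp add: r_def vnorm_sq)
    also have "\<dots> = v \<bullet> s - g \<bullet> s - a * (x \<bullet> s)"
      using x g v s by (subst (1) s_def) (simp add: minus_scalar_prod_distrib[of _ k])
    finally show ?thesis using xs comm_scalar_prod[OF s x(1)] by simp
  qed
  have "r = 0"
  proof (rule ccontr)
    assume "r \<noteq> 0"
    then have r: "r > 0" using vnorm_nonneg[of s] unfolding r_def by linarith
    obtain \<delta> where \<delta>: "\<delta> > 0" and test: "\<forall>x'\<in>carrier_vec k. x' \<bullet> x' = 1 \<longrightarrow> vnorm (x' - x) < \<delta> \<longrightarrow>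
      v \<bullet> (x' - x) - r / 4 * vnorm (x' - x) \<le> g \<bullet> (x' - x) + M * (vnorm (x' - x))\<^sup>2"
      using ineq[of "r / 4"] r by auto
    \<comment> \<open>The caps give, in turn, a test point within \<open>\<delta>\<close>,
      \<open>\<rho> \<le> 2\<close>, and second-order terms at most \<open>1 / 8\<close> of
      \<open>t * r\<^sup>2\<close>. Dividing by \<open>t * r\<^sup>2\<close>, the gain is at least
      \<open>1 / 2\<close> and the choice \<open>r / 4\<close> for \<open>\<epsilon>\<close> costs
      \<open>1 / 4\<close>, so \<open>1 / 2 \<le> 1 / 4 + 1 / 8\<close> would follow.\<close>
    define t where "t = min (min (\<delta> / (2 * r)) (1 / r)) (1 / (8 * (\<bar>a\<bar> / 2 + M + 1)))"
    have D: "\<bar>a\<bar> / 2 + M + 1 > 0" using M by linarith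
    have t: "t > 0" using \<delta> r D by (simp add: t_def)
    have "t \<le> \<delta> / (2 * r)" "t \<le> 1 / r" "t \<le> 1 / (8 * (\<bar>a\<bar> / 2 + M + 1))" by (simp_all add: t_def)
    then have tr: "t * r < \<delta>" "t * r \<le> 1" and tD: "t * (\<bar>a\<bar> / 2 + M + 1) \<le> 1 / 8"
      using r D \<delta> by (simp_all add: field_simps)
    define \<rho> where "\<rho> = sqrt (1 + (t * r)\<^sup>2)"
    have \<rho>2: "\<rho>\<^sup>2 = 1 + (t * r)\<^sup>2" by (simp add: \<rho>_def add_nonneg_nonneg)
    have \<rho>1: "\<rho> \<ge> 1" by (simp add: \<rho>_def)
    have "(t * r)\<^sup>2 \<le> 1" using tr t r by (simp add: power_le_one)
    then have "\<rho>\<^sup>2 \<le> 2\<^sup>2" using \<rho>2 by simp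
    then have \<rho>_le: "\<rho> \<le> 2" using power2_le_imp_le[of \<rho> 2] by simp
    have gap: "0 \<le> 1 - 1 / \<rho>" "1 - 1 / \<rho> \<le> (t * r)\<^sup>2 / 2"
    proof -
      show "0 \<le> 1 - 1 / \<rho>" using \<rho>1 by simp
      have "1 - 1 / \<rho> = (\<rho> - 1) / \<rho>" using \<rho>1 by (simp add: field_simps)
      also have "\<dots> \<le> (\<rho> - 1) / 1" using \<rho>1 by (intro divide_left_mono) auto
      also have "\<dots> \<le> (\<rho> - 1) * (\<rho> + 1) / 2"
        using mult_left_mono[of 2 "\<rho> + 1" "\<rho> - 1"] \<rho>1 by simp
      also have "\<dots> = (t * r)\<^sup>2 / 2" using \<rho>2 by (simp add: power2_eq_square algebra_simps)
      finally show "1 - 1 / \<rho> \<le> (t * r)\<^sup>2 / 2" .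
    qed
    define x' where "x' = (1 / \<rho>) \<cdot>\<^sub>v (x + t \<cdot>\<^sub>v s)"
    have x': "x' \<in> carrier_vec k" using x s by (simp add: x'_def)
    have inner: "u \<bullet> x' = (u \<bullet> x + t * (u \<bullet> s)) / \<rho>" if "u \<in> carrier_vec k" for u
      unfolding x'_def using that x s by (simp add: scalar_prod_add_distrib[of _ k])
    have x'x: "x' \<bullet> x = 1 / \<rho>"
      using inner[OF x(1)] x xs comm_scalar_prod[OF x(1) x'] comm_scalar_prod[OF s x(1)] by simp
    have x's: "x' \<bullet> s = t * r\<^sup>2 / \<rho>"
      using inner[OF s] xs comm_scalar_prod[OF s x'] by (simp add: r_def vnorm_sq)
    have "x' \<bullet> x' = (1 + (t * r)\<^sup>2) / \<rho>\<^sup>2"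
      using inner[OF x'] x'x x's by (simp add: power2_eq_square add_divide_distrib)
    then have unit: "x' \<bullet> x' = 1" using \<rho>2 \<rho>1 by (metis divide_self not_one_le_zero power_eq_0_iff)
    have "(vnorm (x' - x))\<^sup>2 = 2 * (1 - 1 / \<rho>)"
      using x x' unit x'x comm_scalar_prod[OF x(1) x'] unfolding vnorm_sq
      by (simp add: minus_scalar_prod_distrib[of _ k] scalar_prod_minus_distrib[of _ k])
    also have "\<dots> \<le> 2 * ((t * r)\<^sup>2 / 2)" by (intro mult_left_mono gap(2)) simp
    finally have n2: "(vnorm (x' - x))\<^sup>2 \<le> (t * r)\<^sup>2" by simp
    then have n1: "vnorm (x' - x) \<le> t * r" using power2_le_imp_le t r by simp
    have diff: "u \<bullet> (x' - x) = (1 / \<rho> - 1) * (u \<bullet> x) + t / \<rho> * (u \<bullet> s)" if "u \<in> carrier_vec k" for u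
      using scalar_prod_minus_distrib[OF that x' x(1)] inner[OF that] by (simp add: field_simps add_divide_distrib)
    have "v \<bullet> (x' - x) - g \<bullet> (x' - x) \<le> r / 4 * vnorm (x' - x) + M * (vnorm (x' - x))\<^sup>2"
    proof -
      have "vnorm (x' - x) < \<delta>" using n1 tr(1) by linarith
      then show ?thesis using test x' unit by fastforce
    qed
    also have "\<dots> \<le> r / 4 * (t * r) + M * (t * r)\<^sup>2"
      using n1 n2 r M by (intro add_mono mult_left_mono) auto
    also have "v \<bullet> (x' - x) - g \<bullet> (x' - x) = (1 / \<rho> - 1) * a + t / \<rho> * r\<^sup>2"
      unfolding diff[OF v] diff[OF g(1)] es[symmetric] g(2) a_def by (simp add: algebra_simps)
    finally have "t / \<rho> * r\<^sup>2 \<le> (1 - 1 / \<rho>) * a + r / 4 * (t * r) + M * (t * r)\<^sup>2" by (simp add: algebra_simps)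
    moreover have "(1 - 1 / \<rho>) * a \<le> (t * r)\<^sup>2 / 2 * \<bar>a\<bar>"
    proof -
      have "(1 - 1 / \<rho>) * a \<le> (1 - 1 / \<rho>) * \<bar>a\<bar>" using gap(1) by (intro mult_left_mono) auto
      also have "\<dots> \<le> (t * r)\<^sup>2 / 2 * \<bar>a\<bar>" using gap(2) by (intro mult_right_mono) auto
      finally show ?thesis .
    qed
    moreover have "t / 2 * r\<^sup>2 \<le> t / \<rho> * r\<^sup>2"
      using \<rho>_le \<rho>1 t by (intro mult_right_mono divide_left_mono) auto
    ultimately have "t / 2 * r\<^sup>2 \<le> (t * r)\<^sup>2 / 2 * \<bar>a\<bar> + r / 4 * (t * r) + M * (t * r)\<^sup>2" by linarith
    then have "(t * r\<^sup>2) * (1 / 2) \<le> (t * r\<^sup>2) * (t * (\<bar>a\<bar> / 2 + M) + 1 / 4)"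
      by (simp add: power2_eq_square algebra_simps)
    moreover have "t * r\<^sup>2 > 0" using t r by simp
    ultimately have "1 / 2 \<le> t * (\<bar>a\<bar> / 2 + M) + 1 / 4" by (simp only: mult_le_cancel_left_pos)
    then show False using tD t by (simp add: algebra_simps)
  qed
  then have "s = 0\<^sub>v k" using vnorm_eq_0 s by (simp add: r_def)
  then have "v $ i - g $ i - a * x $ i = 0" if "i < k" for i
    using that x g v by (auto simp: s_def vec_eq_iff)
  then show ?thesis using x g v by (auto simp: a_def algebra_simps intro!: eq_vecI)
qed

section \<open>The gradient of the value function at stationary points\<close>

context hankel_approximation
begin

lemma row_carrier_1 [simp]: "R \<in> carrier_mat 1 p \<Longrightarrow> row R 0 \<in> carrier_vec p"
  by (auto simp: row_def)

lemma frob_row: "V \<in> carrier_mat 1 p \<Longrightarrow> R \<in> carrier_mat 1 p \<Longrightarrow> frob V R = row V 0 \<bullet> row R 0"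
  by (auto simp: frob_def scalar_prod_def atLeast0LessThan)

lemma mnorm_row: "R \<in> carrier_mat 1 p \<Longrightarrow> mnorm R = vnorm (row R 0)"
  by (simp add: gnorm_def vip_def frob_row)

lemma row_diff: "V \<in> carrier_mat 1 p \<Longrightarrow> R \<in> carrier_mat 1 p \<Longrightarrow> row (V - R) 0 = row V 0 - row R 0"
  by (auto intro!: eq_vecI)

lemma Theta_iff:
  assumes R: "R \<in> carrier_mat 1 p"
  shows "R \<in> Theta p \<longleftrightarrow> row R 0 \<bullet> row R 0 = 1"
proof -
  have "R * R\<^sup>T = 1\<^sub>m 1 \<longleftrightarrow> (R * R\<^sup>T) $$ (0, 0) = 1" using R by (auto simp: mat_eq_iff)
  also have "(R * R\<^sup>T) $$ (0, 0) = row R 0 \<bullet> row R 0" using R by simp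
  finally show ?thesis using R by (simp add: Theta_def)
qed

text \<open>The subgradient inequality and the upper model squeeze \<open>Psi\<close> near
  \<open>R\<close> on the sphere, so \<open>A y *\<^sub>v w\<close> is the tangential part of
  \<open>V\<close>. The crude factor \<open>2\<close> suffices, since \<open>V\<close> will tend to
  zero.\<close>

lemma frechet_subgradient_tangential:
  assumes V: "V \<in> frechet_subdiff (carrier_mat 1 p) frob (Psi_tilde d p q A yh) R"
    and kkt: "kkt (row R 0) y w"
  shows "vnorm (A y *\<^sub>v w) \<le> 2 * mnorm V"
proof -
  let ?\<Psi> = "Psi_tilde d p q A yh"
  have VR: "V \<in> carrier_mat 1 p" "R \<in> carrier_mat 1 p" and fin: "\<bar>?\<Psi> R\<bar> \<noteq> \<infinity>"
    and sub: "\<And>\<epsilon>. \<epsilon> > 0 \<Longrightarrow> \<exists>\<delta>>0. \<forall>R'\<in>carrier_mat 1 p. mnorm (R' - R) < \<delta> \<longrightarrow>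
        ereal (real_of_ereal (?\<Psi> R) + frob V (R' - R) - \<epsilon> * mnorm (R' - R)) \<le> ?\<Psi> R'"
    using V by (auto simp: frechet_subdiff_def)
  define x where "x = row R 0"
  define v where "v = row V 0"
  define g where "g = A y *\<^sub>v w"
  have k: "y \<in> carrier_vec d" "w \<in> carrier_vec q" "C x *\<^sub>v y = 0\<^sub>v q" using kkt by (auto simp: kkt_def x_def)
  have "R \<in> Theta p" using fin by (auto simp: Psi_tilde_def split: if_splits)
  then have x: "x \<in> carrier_vec p" "x \<bullet> x = 1" using Theta_iff VR(2) by (auto simp: x_def)
  then have x0: "x \<noteq> 0\<^sub>v p" by auto
  have v: "v \<in> carrier_vec p" and g: "g \<in> carrier_vec p" using VR k by (auto simp: v_def g_def)
  have gx: "g \<bullet> x = 0" using bilinear[OF x(1) k(1,2)] k by (simp add: g_def)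
  have \<Psi>R: "real_of_ereal (?\<Psi> R) = 1 / 2 * (vnorm (y - yh))\<^sup>2"
    using \<open>R \<in> Theta p\<close> Psi_kkt[OF VR(2) kkt] by (simp add: Psi_tilde_def)
  obtain \<delta>0 M where \<delta>0: "\<delta>0 > 0" and M: "M \<ge> 0" and up:
    "\<forall>x'\<in>carrier_vec p. vnorm (x' - x) < \<delta>0 \<longrightarrow> (\<exists>y'\<in>carrier_vec d. C x' *\<^sub>v y' = 0\<^sub>v q \<and>
      1 / 2 * (vnorm (y' - yh))\<^sup>2 \<le> 1 / 2 * (vnorm (y - yh))\<^sup>2 + (A y *\<^sub>v w) \<bullet> (x' - x) + M * (vnorm (x' - x))\<^sup>2)"
    by (rule feasible_upper_model[OF kkt[folded x_def] x0])
  have "g = v - (v \<bullet> x) \<cdot>\<^sub>v x"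
  proof (rule sphere_first_order[OF x g gx v M])
    fix \<epsilon> :: real assume "\<epsilon> > 0"
    from sub[OF this] obtain \<delta> where \<delta>: "\<delta> > 0" and lower: "\<forall>R'\<in>carrier_mat 1 p. mnorm (R' - R) < \<delta> \<longrightarrow>
        ereal (real_of_ereal (?\<Psi> R) + frob V (R' - R) - \<epsilon> * mnorm (R' - R)) \<le> ?\<Psi> R'" by blast
    show "\<exists>\<delta>>0. \<forall>x'\<in>carrier_vec p. x' \<bullet> x' = 1 \<longrightarrow> vnorm (x' - x) < \<delta> \<longrightarrow>
      v \<bullet> (x' - x) - \<epsilon> * vnorm (x' - x) \<le> g \<bullet> (x' - x) + M * (vnorm (x' - x))\<^sup>2"
    proof (intro exI[of _ "min \<delta> \<delta>0"] conjI ballI impI)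
      show "0 < min \<delta> \<delta>0" using \<delta> \<delta>0 by simp
      fix x' assume x': "x' \<in> carrier_vec p" "x' \<bullet> x' = 1" "vnorm (x' - x) < min \<delta> \<delta>0"
      define R' where "R' = mat 1 p (\<lambda>(i, j). x' $ j)"
      have R': "R' \<in> carrier_mat 1 p" "row R' 0 = x'" using x' by (auto simp: R'_def intro!: eq_vecI)
      have dR: "R' - R \<in> carrier_mat 1 p" "row (R' - R) 0 = x' - x"
        using R' VR row_diff[OF R'(1) VR(2)] by (auto simp: x_def minus_carrier_mat)
      obtain y' where y': "y' \<in> carrier_vec d" "C x' *\<^sub>v y' = 0\<^sub>v q"
        "1 / 2 * (vnorm (y' - yh))\<^sup>2 \<le> 1 / 2 * (vnorm (y - yh))\<^sup>2 + g \<bullet> (x' - x) + M * (vnorm (x' - x))\<^sup>2"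
        using up x' unfolding g_def by auto
      have "ereal (real_of_ereal (?\<Psi> R) + frob V (R' - R) - \<epsilon> * mnorm (R' - R)) \<le> ?\<Psi> R'"
        by (rule lower[rule_format, OF R'(1)]) (use x'(3) mnorm_row[OF dR(1)] dR(2) in simp)
      also have "?\<Psi> R' = ereal (Psi d q A yh R')" using R' x'(2) Theta_iff[OF R'(1)] by (simp add: Psi_tilde_def)
      finally have "1 / 2 * (vnorm (y - yh))\<^sup>2 + v \<bullet> (x' - x) - \<epsilon> * vnorm (x' - x) \<le> Psi d q A yh R'"
        using \<Psi>R frob_row[OF VR(1) dR(1)] mnorm_row[OF dR(1)] dR(2) by (simp add: v_def)
      also have "\<dots> \<le> 1 / 2 * (vnorm (y' - yh))\<^sup>2" using Psi_le[OF R'(1) y'(1)] y'(2) R'(2) by simp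
      finally show "v \<bullet> (x' - x) - \<epsilon> * vnorm (x' - x) \<le> g \<bullet> (x' - x) + M * (vnorm (x' - x))\<^sup>2"
        using y'(3) by linarith
    qed
  qed
  moreover have "vnorm (v - (v \<bullet> x) \<cdot>\<^sub>v x) \<le> vnorm v + \<bar>v \<bullet> x\<bar> * vnorm x"
    using vnorm_diff_triangle[OF v, of "(v \<bullet> x) \<cdot>\<^sub>v x"] x by simp
  moreover have "vnorm x = 1" using x by (simp add: gnorm_def vip_def)
  moreover have "\<bar>v \<bullet> x\<bar> \<le> vnorm v * vnorm x" using scalar_prod_abs_le v x by blast
  ultimately show ?thesis using mnorm_row[OF VR(1)] by (simp add: g_def v_def)
qed

text \<open>Subtracting the two KKT systems shows that minimizer and multiplier move by
  \<open>O(vnorm (x' - x))\<close>; the base point is fixed, so the constant may depend on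
  it.\<close>

lemma gradient_lipschitz:
  assumes kkt: "kkt x y w" and x0: "x \<noteq> 0\<^sub>v p"
  obtains \<delta> L where "\<delta> > 0" "\<forall>x' y' w'. kkt x' y' w' \<longrightarrow> vnorm (x' - x) < \<delta> \<longrightarrow>
      vnorm (A y' *\<^sub>v w' - A y *\<^sub>v w) \<le> L * vnorm (x' - x)"
proof -
  have k: "x \<in> carrier_vec p" "y \<in> carrier_vec d" "w \<in> carrier_vec q" "y = yh - (C x)\<^sup>T *\<^sub>v w" "C x *\<^sub>v y = 0\<^sub>v q"
    using kkt by (auto simp: kkt_def)
  obtain c where c: "c > 0" and lb: "\<forall>x'\<in>carrier_vec p. vnorm (x' - x) < c \<longrightarrow> (\<forall>w\<in>carrier_vec q. c * vnorm w \<le> vnorm ((C x')\<^sup>T *\<^sub>v w))"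
    by (rule CT_lower_bound[OF k(1) x0])
  \<comment> \<open>Chosen for \<open>vnorm z \<le> B * vnorm h\<close>; \<open>E\<close> below is
    the corresponding constant for \<open>y' - y\<close>. Here \<open>vnorm x + c\<close> bounds
    \<open>vnorm x'\<close>.\<close>
  define B where "B = (K * vnorm y + K * (vnorm x + c) * (K * vnorm w)) / c"
  have B: "B \<ge> 0" using c K_pos by (simp add: B_def add_nonneg_nonneg)
  define E where "E = B + K * vnorm w"
  have E: "E \<ge> 0" using B K_pos by (simp add: E_def)
  have "vnorm (A y' *\<^sub>v w' - A y *\<^sub>v w) \<le> (K * (vnorm y + E * c) * (B / c) + K * E * vnorm w) * vnorm (x' - x)"
    if kkt': "kkt x' y' w'" and small: "vnorm (x' - x) < c" for x' y' w'
  proof -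
    have k': "x' \<in> carrier_vec p" "y' \<in> carrier_vec d" "w' \<in> carrier_vec q" "y' = yh - (C x')\<^sup>T *\<^sub>v w'" "C x' *\<^sub>v y' = 0\<^sub>v q"
      using kkt' by (auto simp: kkt_def)
    define h where "h = x' - x"
    define e where "e = w' - w"
    define z where "z = (C x')\<^sup>T *\<^sub>v e"
    have h: "h \<in> carrier_vec p" and e: "e \<in> carrier_vec q" using k k' by (simp_all add: h_def e_def)
    have z: "z \<in> carrier_vec d" using e by (simp add: z_def)
    define f where "f = (C h)\<^sup>T *\<^sub>v w"
    have f: "f \<in> carrier_vec d" using k(3) by (simp add: f_def)
    have nf: "vnorm f \<le> K * vnorm h * vnorm w" unfolding f_def using CT_mult_bound h k(3) by blast
    have zeq: "z = (y - y') - f"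
    proof -
      have "z = (C x')\<^sup>T *\<^sub>v w' - (C x')\<^sup>T *\<^sub>v w"
        unfolding z_def e_def using k k' by (intro mult_minus_distrib_mat_vec[OF CT_carrier])
      moreover have "f = (C x')\<^sup>T *\<^sub>v w - (C x)\<^sup>T *\<^sub>v w"
        unfolding f_def h_def using CT_diff_mult[OF k'(1) k(1) k(3)] .
      ultimately show ?thesis unfolding k(4) k'(4)
        using CT_vec[OF k(3), of x] CT_vec[OF k(3), of x'] CT_vec[OF k'(3), of x'] by auto
    qed
    \<comment> \<open>Applying \<open>C x'\<close> removes the unknown \<open>y'\<close>, and
      \<open>C x *\<^sub>v y\<close> vanishes too, so only terms linear in \<open>h\<close> remain
      on the right.\<close>
    have "C x' *\<^sub>v z = C h *\<^sub>v y - C x' *\<^sub>v f"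
    proof -
      have "C x' *\<^sub>v z = (C x' *\<^sub>v y - C x' *\<^sub>v y') - C x' *\<^sub>v f"
        unfolding zeq using k k' f by (simp add: mult_minus_distrib_mat_vec[OF C_carrier])
      moreover have "C h *\<^sub>v y = C x' *\<^sub>v y - C x *\<^sub>v y" unfolding h_def using C_diff_mult[OF k'(1) k(1,2)] .
      ultimately show ?thesis using k(5) k'(5) C_vec[OF k(2), of x'] C_vec[OF f, of x'] by auto
    qed
    then have "vnorm (C x' *\<^sub>v z) \<le> vnorm (C h *\<^sub>v y) + vnorm (C x' *\<^sub>v f)"
      using vnorm_diff_triangle[OF C_vec[OF k(2), of h] C_vec[OF f, of x']] by simp
    also have "\<dots> \<le> K * vnorm h * vnorm y + K * vnorm x' * vnorm f"
      using C_mult_bound[OF h k(2)] C_mult_bound[OF k'(1) f] by linarith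
    also have "K * vnorm x' * vnorm f \<le> K * (vnorm x + c) * (K * vnorm h * vnorm w)"
    proof -
      have "x' = h + x" using k k' by (auto simp: h_def)
      then have "vnorm x' \<le> vnorm x + c" using vnorm_triangle[OF h k(1)] small by (simp add: h_def)
      then show ?thesis using nf K_pos c by (intro mult_mono mult_left_mono mult_nonneg_nonneg add_nonneg_nonneg) auto
    qed
    also have "K * vnorm h * vnorm y + K * (vnorm x + c) * (K * vnorm h * vnorm w) = c * (B * vnorm h)"
      using c by (simp add: B_def field_simps)
    finally have Cz: "vnorm (C x' *\<^sub>v z) \<le> c * (B * vnorm h)" by simp
    have lb': "c * vnorm v \<le> vnorm ((C x')\<^sup>T *\<^sub>v v)" if "v \<in> carrier_vec q" for v
      using lb k'(1) small that by blast
    have "c * vnorm z \<le> c * (B * vnorm h)"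
      using gram_bound[OF C_carrier c lb' e] Cz by (simp add: z_def)
    then have nz: "vnorm z \<le> B * vnorm h" using c by (simp only: mult_le_cancel_left_pos)
    have ne: "vnorm e \<le> B / c * vnorm h"
      using lb'[OF e] nz c by (simp add: z_def field_simps)
    define u where "u = y' - y"
    have u: "u \<in> carrier_vec d" using k k' by (simp add: u_def)
    have "u = - (z + f)" using k(2) k'(2) f by (auto simp: u_def zeq)
    then have "vnorm u \<le> vnorm z + vnorm f" using vnorm_triangle[OF z f] by simp
    then have nu: "vnorm u \<le> E * vnorm h" using nz nf by (simp add: E_def algebra_simps)
    have ny': "vnorm y' \<le> vnorm y + E * c"
    proof -
      have "y' = y + u" using k k' by (auto simp: u_def)
      then have "vnorm y' \<le> vnorm y + vnorm u" using vnorm_triangle[OF k(2) u] by simp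
      moreover have "E * vnorm h \<le> E * c" using small E by (intro mult_left_mono) (auto simp: h_def)
      ultimately show ?thesis using nu by linarith
    qed
    have "A y' *\<^sub>v w' - A y *\<^sub>v w = A y' *\<^sub>v e + A u *\<^sub>v w"
    proof -
      have "A y' *\<^sub>v e = A y' *\<^sub>v w' - A y' *\<^sub>v w"
        unfolding e_def using k k' by (intro mult_minus_distrib_mat_vec[OF A_carrier])
      moreover have "A u *\<^sub>v w = A y' *\<^sub>v w - A y *\<^sub>v w"
        unfolding u_def A_diff[OF k'(2) k(2)] using k k' by (intro minus_mult_distrib_mat_vec[OF A_carrier A_carrier])
      moreover have split: "a - b = (a - v) + (v - b)" if "a \<in> carrier_vec p" "b \<in> carrier_vec p" "v \<in> carrier_vec p" for a b v :: "real vec"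
        using that by auto
      ultimately show ?thesis
        using split[OF A_vec[OF k'(2) k'(3)] A_vec[OF k(2) k(3)] A_vec[OF k'(2) k(3)]] by (simp only:)
    qed
    then have "vnorm (A y' *\<^sub>v w' - A y *\<^sub>v w) \<le> vnorm (A y' *\<^sub>v e) + vnorm (A u *\<^sub>v w)"
      using vnorm_triangle[OF A_vec[OF k'(2) e] A_vec[OF u k(3)]] by simp
    also have "\<dots> \<le> K * vnorm y' * vnorm e + K * vnorm u * vnorm w"
      using A_mult_bound[OF k'(2) e] A_mult_bound[OF u k(3)] by linarith
    also have "\<dots> \<le> K * (vnorm y + E * c) * (B / c * vnorm h) + K * (E * vnorm h) * vnorm w"
      using ny' ne nu K_pos E c by (intro add_mono mult_mono mult_nonneg_nonneg add_nonneg_nonneg) auto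
    finally show ?thesis using c by (simp add: h_def algebra_simps)
  qed
  then show ?thesis using that[OF c] by blast
qed

text \<open>Along the approximating sequences the fixed number
  \<open>vnorm (A y *\<^sub>v w)\<close> is at most a multiple of the subgradient norm plus a
  multiple of the distance to \<open>R\<close>, and both tend to zero.\<close>

lemma stationary_gradient_zero:
  assumes stat: "0\<^sub>m 1 p \<in> limiting_subdiff (carrier_mat 1 p) frob (Psi_tilde d p q A yh) R"
    and kkt: "kkt (row R 0) y w"
  shows "A y *\<^sub>v w = 0\<^sub>v p"
proof -
  let ?\<Psi> = "Psi_tilde d p q A yh"
  have R: "R \<in> carrier_mat 1 p" and fin: "\<bar>?\<Psi> R\<bar> \<noteq> \<infinity>" using stat by (auto simp: limiting_subdiff_def)
  obtain Rs Vs where seq: "\<And>k. Rs k \<in> carrier_mat 1 p" "\<And>k. Vs k \<in> frechet_subdiff (carrier_mat 1 p) frob ?\<Psi> (Rs k)"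
    and lim: "(\<lambda>k. mnorm (Rs k - R)) \<longlonglongrightarrow> 0" "(\<lambda>k. mnorm (Vs k - 0\<^sub>m 1 p)) \<longlonglongrightarrow> 0"
    using stat unfolding limiting_subdiff_def by blast
  have unit: "row S 0 \<noteq> 0\<^sub>v p" if S: "S \<in> carrier_mat 1 p" "\<bar>?\<Psi> S\<bar> \<noteq> \<infinity>" for S
  proof -
    have "S \<in> Theta p" using S(2) by (auto simp: Psi_tilde_def split: if_splits)
    then show ?thesis using Theta_iff[OF S(1)] by auto
  qed
  have k: "y \<in> carrier_vec d" "w \<in> carrier_vec q" using kkt by (auto simp: kkt_def)
  obtain \<delta> L where \<delta>: "\<delta> > 0" and L: "\<forall>x' y' w'. kkt x' y' w' \<longrightarrow> vnorm (x' - row R 0) < \<delta> \<longrightarrow>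
      vnorm (A y' *\<^sub>v w' - A y *\<^sub>v w) \<le> L * vnorm (x' - row R 0)"
    by (rule gradient_lipschitz[OF kkt unit[OF R fin]])
  have "eventually (\<lambda>k. mnorm (Rs k - R) < \<delta>) sequentially" using order_tendstoD(2)[OF lim(1) \<delta>] .
  then have "eventually (\<lambda>k. vnorm (A y *\<^sub>v w) \<le> 2 * mnorm (Vs k - 0\<^sub>m 1 p) + L * mnorm (Rs k - R)) sequentially"
  proof eventually_elim
    case (elim k)
    have fin_k: "\<bar>?\<Psi> (Rs k)\<bar> \<noteq> \<infinity>" and Vk: "Vs k \<in> carrier_mat 1 p"
      using seq(2)[of k] by (auto simp: frechet_subdiff_def)
    obtain y' w' where kkt': "kkt (row (Rs k) 0) y' w'"
      by (rule kkt_exists[OF row_carrier_1[OF seq(1)] unit[OF seq(1) fin_k]])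
    have k': "y' \<in> carrier_vec d" "w' \<in> carrier_vec q" using kkt' by (auto simp: kkt_def)
    have dist: "mnorm (Rs k - R) = vnorm (row (Rs k) 0 - row R 0)"
      using mnorm_row[OF minus_carrier_mat[OF R]] row_diff[OF seq(1) R] by simp
    have "A y *\<^sub>v w = A y' *\<^sub>v w' - (A y' *\<^sub>v w' - A y *\<^sub>v w)"
      using A_vec[OF k] A_vec[OF k'] by auto
    then have "vnorm (A y *\<^sub>v w) \<le> vnorm (A y' *\<^sub>v w') + vnorm (A y' *\<^sub>v w' - A y *\<^sub>v w)"
      using vnorm_diff_triangle[OF A_vec[OF k'], of "A y' *\<^sub>v w' - A y *\<^sub>v w"] A_vec[OF k] A_vec[OF k'] by simp
    moreover have "vnorm (A y' *\<^sub>v w') \<le> 2 * mnorm (Vs k)"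
      using frechet_subgradient_tangential[OF seq(2) kkt'] .
    moreover have "vnorm (A y' *\<^sub>v w' - A y *\<^sub>v w) \<le> L * mnorm (Rs k - R)"
      using L kkt' elim dist by simp
    moreover have "Vs k - 0\<^sub>m 1 p = Vs k" using Vk by auto
    ultimately show ?case by simp
  qed
  moreover have "(\<lambda>k. 2 * mnorm (Vs k - 0\<^sub>m 1 p) + L * mnorm (Rs k - R)) \<longlonglongrightarrow> 2 * 0 + L * 0"
    by (intro tendsto_intros lim)
  ultimately have "vnorm (A y *\<^sub>v w) \<le> 0"
    using tendsto_lowerbound[of _ "2 * 0 + L * 0" sequentially "vnorm (A y *\<^sub>v w)"] by simp
  then show ?thesis using vnorm_eq_0[OF _ A_vec[OF k]] vnorm_nonneg[of "A y *\<^sub>v w"] by simp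
qed

end

section \<open>Stationary points\<close>

context hankel_structure
begin

text \<open>By the trilinear identity the right side represents the functional; testing with the
  difference of two representatives gives the uniqueness that \<open>THE\<close> requires.\<close>

lemma adjoint_op_outer:
  assumes x: "x \<in> carrier_vec p" and w: "w \<in> carrier_vec q"
  shows "adjoint_op d A (outer x w) = (C x)\<^sup>T *\<^sub>v w"
  unfolding adjoint_op_def
proof (rule the_equality)
  have eq: "frob (A y) (outer x w) = vip y ((C x)\<^sup>T *\<^sub>v w)" if y: "y \<in> carrier_vec d" for y
  proof -
    have "frob (A y) (outer x w) = x \<bullet> (A y *\<^sub>v w)"
      using frob_commute[of "A y" p q] frob_outer[OF x w] x w y by simp
    also have "\<dots> = w \<bullet> (C x *\<^sub>v y)"
      using bilinear[OF x y w] comm_scalar_prod[OF x A_vec[OF y w]] by simp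
    also have "\<dots> = y \<bullet> ((C x)\<^sup>T *\<^sub>v w)"
      using mult_mat_vec_adjoint[OF C_carrier y w] comm_scalar_prod[OF y CT_vec[OF w]] by simp
    finally show ?thesis by (simp add: vip_def)
  qed
  then show "(C x)\<^sup>T *\<^sub>v w \<in> carrier_vec d \<and> (\<forall>y\<in>carrier_vec d. frob (A y) (outer x w) = vip y ((C x)\<^sup>T *\<^sub>v w))"
    using w by simp
  fix u assume "u \<in> carrier_vec d \<and> (\<forall>y\<in>carrier_vec d. frob (A y) (outer x w) = vip y u)"
  then have u: "u \<in> carrier_vec d" "\<And>y. y \<in> carrier_vec d \<Longrightarrow> y \<bullet> u = y \<bullet> ((C x)\<^sup>T *\<^sub>v w)"
    using eq by (auto simp: vip_def)
  define e where "e = u - (C x)\<^sup>T *\<^sub>v w"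
  have e: "e \<in> carrier_vec d" using u(1) w by (simp add: e_def)
  have "e \<bullet> e = e \<bullet> u - e \<bullet> ((C x)\<^sup>T *\<^sub>v w)"
    by (subst (2) e_def) (rule scalar_prod_minus_distrib[OF e u(1) CT_vec[OF w]])
  then have "e = 0\<^sub>v d" using u(2)[OF e] scalar_prod_self_eq_0 e by simp
  then have "u $ i - ((C x)\<^sup>T *\<^sub>v w) $ i = 0" if "i < d" for i
    using that u(1) CT_vec[OF w, of x] by (metis e_def carrier_vecD index_minus_vec(1) index_zero_vec(1))
  then show "u = (C x)\<^sup>T *\<^sub>v w" using u(1) CT_vec[OF w, of x] by (intro eq_vecI) (auto simp del: index_mult_mat_vec)
qed

text \<open>\<open>A\<close> maps feasible points near \<open>y\<close> to matrices of bounded rank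
  near \<open>A y\<close>, with distances stretched by at most \<open>K\<close>; hence the rescaled
  \<open>\<epsilon> / K\<close> and \<open>\<delta> / K\<close>.\<close>

lemma frechet_normal_pullback:
  assumes x: "x \<in> carrier_vec p" and w: "w \<in> carrier_vec q" and y: "y \<in> carrier_vec d"
    and normal: "outer x w \<in> frechet_normal (carrier_mat p q) frob {X \<in> carrier_mat p q. mrank X \<le> m} (A y)"
  shows "(C x)\<^sup>T *\<^sub>v w \<in> frechet_normal (carrier_vec d) vip {y \<in> carrier_vec d. mrank (A y) \<le> m} y"
  unfolding frechet_normal_def mem_Collect_eq
proof (intro conjI allI impI)
  show "(C x)\<^sup>T *\<^sub>v w \<in> carrier_vec d" using w by simp
  show "y \<in> carrier_vec d" using y .
  show "mrank (A y) \<le> m" using normal by (simp add: frechet_normal_def)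
  fix \<epsilon> :: real assume "\<epsilon> > 0"
  then have "\<epsilon> / K > 0" using K_pos by simp
  then obtain \<delta> where \<delta>: "\<delta> > 0" and main: "\<And>X'. X' \<in> carrier_mat p q \<Longrightarrow> mrank X' \<le> m \<Longrightarrow> mnorm (X' - A y) < \<delta> \<Longrightarrow>
      frob (outer x w) (X' - A y) \<le> \<epsilon> / K * mnorm (X' - A y)"
    using normal unfolding frechet_normal_def by blast
  show "\<exists>\<delta>>0. \<forall>y'\<in>{y \<in> carrier_vec d. mrank (A y) \<le> m}. vnorm (y' - y) < \<delta> \<longrightarrow>
      vip ((C x)\<^sup>T *\<^sub>v w) (y' - y) \<le> \<epsilon> * vnorm (y' - y)"
  proof (intro exI[of _ "\<delta> / K"] conjI ballI impI)
    show "0 < \<delta> / K" using \<delta> K_pos by simp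
    fix y' assume "y' \<in> {y \<in> carrier_vec d. mrank (A y) \<le> m}" and small: "vnorm (y' - y) < \<delta> / K"
    then have y': "y' \<in> carrier_vec d" "mrank (A y') \<le> m" by auto
    define u where "u = y' - y"
    have u: "u \<in> carrier_vec d" and Au: "A y' - A y = A u" using y y' A_diff by (simp_all add: u_def)
    have bound: "mnorm (A u) \<le> K * vnorm u" using A_bound u by blast
    also have "\<dots> < \<delta>" using small K_pos by (simp add: u_def field_simps)
    finally have "frob (outer x w) (A u) \<le> \<epsilon> / K * mnorm (A u)" using main[of "A y'"] y' Au by simp
    also have "\<dots> \<le> \<epsilon> / K * (K * vnorm u)" using bound \<open>\<epsilon> / K > 0\<close> by (intro mult_left_mono) auto
    also have "\<dots> = \<epsilon> * vnorm u" using K_pos by simp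
    also have "frob (outer x w) (A u) = x \<bullet> (A u *\<^sub>v w)" using frob_outer[OF x w] u by simp
    also have "\<dots> = w \<bullet> (C x *\<^sub>v u)" using bilinear[OF x u w] comm_scalar_prod[OF x A_vec[OF u w]] by simp
    also have "\<dots> = vip ((C x)\<^sup>T *\<^sub>v w) u" using mult_mat_vec_adjoint[OF C_carrier u w] by (simp add: vip_def)
    finally show "vip ((C x)\<^sup>T *\<^sub>v w) (y' - y) \<le> \<epsilon> * vnorm (y' - y)" by (simp add: u_def)
  qed
qed

end

lemma (in hankel_approximation) stationary_imp_normal:
  assumes p: "p = Suc m" and pq: "p \<le> q" and R: "R \<in> carrier_mat 1 p"
    and stat: "0\<^sub>m 1 p \<in> limiting_subdiff (carrier_mat 1 p) frob (Psi_tilde d p q A yh) R"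
    and y: "y \<in> carrier_vec d" "R * A y = 0\<^sub>m 1 q" "1 / 2 * (vnorm (y - yh))\<^sup>2 = Psi d q A yh R"
  shows "\<exists>Z\<in>limiting_normal (carrier_mat p q) frob {X \<in> carrier_mat p q. mrank X \<le> m} (A y).
      0\<^sub>v d = y - yh + adjoint_op d A Z"
    and "mrank (A y) = m \<Longrightarrow> \<exists>u\<in>limiting_normal (carrier_vec d) vip {y \<in> carrier_vec d. mrank (A y) \<le> m} y.
      0\<^sub>v d = y - yh + u"
proof -
  define x where "x = row R 0"
  have "R \<in> Theta p" using stat by (auto simp: limiting_subdiff_def Psi_tilde_def split: if_splits)
  then have x: "x \<in> carrier_vec p" "x \<bullet> x = 1" using Theta_iff R by (auto simp: x_def)
  then have x0: "x \<noteq> 0\<^sub>v p" and nx: "vnorm x = 1" by (auto simp: gnorm_def vip_def)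
  obtain y' w where "kkt x y' w" by (rule kkt_exists[OF x(1) x0])
  \<comment> \<open>The multiplier belongs to the constructed minimizer \<open>y'\<close>;
    uniqueness identifies \<open>y'\<close> with the given \<open>y\<close>.\<close>
  then have kkt: "kkt x y w" using kkt_unique[OF R _ y] by (simp add: x_def)
  then have w: "w \<in> carrier_vec q" and yeq: "y = yh - (C x)\<^sup>T *\<^sub>v w" and "C x *\<^sub>v y = 0\<^sub>v q"
    by (auto simp: kkt_def)
  have null: "(A y)\<^sup>T *\<^sub>v x = 0\<^sub>v q" "A y *\<^sub>v w = 0\<^sub>v p"
    using C_mult[OF y(1) x(1)] \<open>C x *\<^sub>v y = 0\<^sub>v q\<close> stationary_gradient_zero[OF stat] kkt by (simp_all add: x_def)
  have zero: "0\<^sub>v d = y - yh + (C x)\<^sup>T *\<^sub>v w"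
    unfolding yeq using CT_vec[OF w, of x] by auto
  have "outer x w \<in> limiting_normal (carrier_mat p q) frob {X \<in> carrier_mat p q. mrank X \<le> m} (A y)"
    using outer_limiting_normal[of "A y" m q x w] A_carrier[OF y(1)] pq x(1) nx w null by (simp add: p)
  then show "\<exists>Z\<in>limiting_normal (carrier_mat p q) frob {X \<in> carrier_mat p q. mrank X \<le> m} (A y).
      0\<^sub>v d = y - yh + adjoint_op d A Z"
    using adjoint_op_outer[OF x(1) w] zero by (intro bexI[of _ "outer x w"]) simp_all
  assume rank: "mrank (A y) = m"
  have "outer x w \<in> frechet_normal (carrier_mat p q) frob {X \<in> carrier_mat p q. mrank X \<le> m} (A y)"
    unfolding p
  proof (rule outer_frechet_normal)
    show "v = (x \<bullet> v) \<cdot>\<^sub>v x" if "v \<in> carrier_vec (Suc m)" "(A y)\<^sup>T *\<^sub>v v = 0\<^sub>v q" for v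
      using left_null_unique[OF A_carrier[OF y(1), unfolded p] rank x(1)[unfolded p] nx null(1) that] .
  qed (use A_carrier[OF y(1)] x nx w null in \<open>simp_all add: p\<close>)
  then have "(C x)\<^sup>T *\<^sub>v w \<in> limiting_normal (carrier_vec d) vip {y \<in> carrier_vec d. mrank (A y) \<le> m} y"
    by (intro frechet_imp_limiting_normal frechet_normal_pullback[OF x(1) w y(1)]) simp_all
  then show "\<exists>u\<in>limiting_normal (carrier_vec d) vip {y \<in> carrier_vec d. mrank (A y) \<le> m} y. 0\<^sub>v d = y - yh + u"
    using zero by blast
qed

section \<open>The index maps of the two Hankel cases\<close>

lemma hankel_structure_hankel:
  assumes "m < n"
  shows "hankel_structure n (m + 1) (n - m) (\<lambda>i j. i + j) (hankel (m + 1))"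
proof
  fix y :: "real vec" assume "y \<in> carrier_vec n"
  then show "hankel (m + 1) y = mat (m + 1) (n - m) (\<lambda>(i, j). y $ (i + j))"
    \<comment> \<open>The truncated width \<open>n - (m + 1) + 1\<close> equals \<open>n - m\<close>
      only because \<open>m < n\<close>.\<close>
    using assms by (simp add: hankel_def Suc_diff_Suc)
qed (use assms in auto)

lemma hankel_structure_block_hankel:
  assumes "m < n"
  shows "hankel_structure (N * n) (m + 1) (N * (n - m)) (\<lambda>i j. j div (n - m) * n + i + j mod (n - m))
    (block_hankel N n (m + 1))"
proof
  define L where "L = n - m"
  have L: "L > 0" "L \<le> n" "L + m = n" using assms by (auto simp: L_def)
  fix y :: "real vec"
  show "block_hankel N n (m + 1) y = mat (m + 1) (N * (n - m)) (\<lambda>(i, j). y $ (j div (n - m) * n + i + j mod (n - m)))"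
    using assms by (simp add: block_hankel_def Suc_diff_Suc)
  fix i i' j j' :: nat
  show "j div (n - m) * n + i + j mod (n - m) < N * n" if i: "i < m + 1" and j: "j < N * (n - m)"
  proof -
    have "j div L < N" using j L by (simp add: L_def less_mult_imp_div_less)
    then have "Suc (j div L) * n \<le> N * n" by (intro mult_right_mono) auto
    then have "n + j div L * n \<le> N * n" by (simp only: mult_Suc)
    \<comment> \<open>The offset in a block is at most \<open>m + (L - 1) = n - 1\<close>, so the
      entry stays inside its own segment of length \<open>n\<close>.\<close>
    moreover have "i + j mod L < n" using i L mod_less_divisor[OF L(1), of j] by linarith
    ultimately show ?thesis unfolding L_def[symmetric] by linarith
  qed
  show "j div (n - m) * n + i + j mod (n - m) < j div (n - m) * n + i' + j mod (n - m)" if "i < i'"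
    using that by simp
  show "j div (n - m) * n + i + j mod (n - m) < j' div (n - m) * n + i + j' mod (n - m)" if "j < j'"
  proof (cases "j div L = j' div L")
    case True
    then have "j mod L < j' mod L"
      using that div_mult_mod_eq[of j L, unfolded True] div_mult_mod_eq[of j' L] by linarith
    then show ?thesis unfolding L_def[symmetric] True by simp
  next
    case False
    \<comment> \<open>In a later block the segment start has grown by at least \<open>n\<close>,
      more than the column offset \<open>j mod L\<close> can lose.\<close>
    then have "Suc (j div L) \<le> j' div L" using div_le_mono[of j j' L] that by simp
    then have "Suc (j div L) * n \<le> j' div L * n" by (intro mult_right_mono) auto
    then have "n + j div L * n \<le> j' div L * n" by (simp only: mult_Suc)
    moreover have "j mod L < n" using mod_less_divisor[OF L(1), of j] L(2) by linarith
    ultimately show ?thesis unfolding L_def[symmetric] by linarith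
  qed
qed

theorem theorem4p3:
  fixes n N r m d p q :: nat
    and rs :: "nat \<Rightarrow> nat"
    and A :: "real vec \<Rightarrow> real mat"
    and yhat ystar :: "real vec"
    and Rstar :: "real mat"
  assumes "n \<ge> 1" and "N \<ge> 1"
    and "\<forall>i\<in>{1..N}. 0 < rs i \<and> rs i \<le> r"
    and "0 < r" and "r \<le> (n - 1) div 2"
    and cases: "(\<exists>i\<in>{1..N}. d = n \<and> m = rs i \<and> p = rs i + 1 \<and> q = n - rs i \<and>
                    A = hankel (rs i + 1))
             \<or> (d = N * n \<and> m = r \<and> p = r + 1 \<and> q = N * (n - r) \<and>
                    A = block_hankel N n (r + 1))"
    and "yhat \<in> carrier_vec d"
    and "Rstar \<in> carrier_mat 1 p"
    and stationary: "0\<^sub>m 1 p \<in> limiting_subdiff (carrier_mat 1 p) frob (Psi_tilde d p q A yhat) Rstar"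
    and "ystar \<in> carrier_vec d"
    and "Rstar * A ystar = 0\<^sub>m 1 q"
    and "(1/2) * (gnorm vip (ystar - yhat))\<^sup>2 = Psi d q A yhat Rstar"
  shows "0\<^sub>v d \<in> {ystar - yhat + adjoint_op d A Z | Z.
            Z \<in> limiting_normal (carrier_mat p q) frob {X \<in> carrier_mat p q. mrank X \<le> m} (A ystar)}
       \<and> (mrank (A ystar) = m \<longrightarrow>
         0\<^sub>v d \<in> {ystar - yhat + w | w.
            w \<in> limiting_normal (carrier_vec d) vip {y \<in> carrier_vec d. mrank (A y) \<le> m} ystar})"
proof -
  have m: "m \<le> r" using cases assms(3) by auto
  then have m2: "2 * m + 1 \<le> n" using assms(4,5) by linarith
  then have "m < n" by linarith
  have p: "p = Suc m" using cases by auto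
  have "n - m \<le> q \<and> (\<exists>\<kappa>. hankel_structure d p q \<kappa> A)"
    using cases
  proof (elim disjE bexE conjE)
    fix i assume "d = n" "m = rs i" "p = rs i + 1" "q = n - rs i" "A = hankel (rs i + 1)"
    then show ?thesis using hankel_structure_hankel[OF \<open>m < n\<close>] by auto
  next
    assume eq: "d = N * n" "m = r" "p = r + 1" "q = N * (n - r)" "A = block_hankel N n (r + 1)"
    have "1 * (n - r) \<le> N * (n - r)" using \<open>N \<ge> 1\<close> by (rule mult_right_mono) simp
    moreover have "hankel_structure d p q (\<lambda>i j. j div (n - m) * n + i + j mod (n - m)) A"
      unfolding eq by (rule hankel_structure_block_hankel) (use \<open>m < n\<close> eq(2) in simp)
    ultimately show ?thesis using eq by auto
  qed
  then obtain \<kappa> where nq: "n - m \<le> q" and "hankel_structure d p q \<kappa> A" by blast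
  \<comment> \<open>From \<open>2 * m + 1 \<le> n\<close>: \<open>p = m + 1\<close> is at most
    \<open>n - m\<close>, the width of a single block.\<close>
  have pq: "p \<le> q" using nq m2 p by linarith
  from \<open>hankel_structure d p q \<kappa> A\<close> interpret hankel_approximation d p q \<kappa> A yhat
    using assms(7) by (simp add: hankel_approximation_def hankel_approximation_axioms_def)
  show ?thesis
    using stationary_imp_normal[OF p pq assms(8) stationary assms(10,11,12)] by blast
qed

end
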